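(* The van Lint–Schrijver graphs are not triply transitive.
   Context: Let $p$ be a prime, $e$ an odd prime such that $p$ is a primitive root modulo $e$, and $q=p^f$ with $f=(e-1)\ell$ for some integer $\ell\ge1$ (so $e\mid q-1$). Let $K\le\mathbb F_q^*$ be the subgroup of $e$-th powers of non-zero elements. The van Lint–Schrijver graph is the Cayley graph on the additive group of $\mathbb F_q$ with connection set $K$ (i.e. $x\sim y$ iff $x-y\in K$). For a strongly regular graph $\Gamma=(V,E)$: $A_0=I$, $A_1$ its adjacency matrix, $A_2=J-I-A_1$; for a vertex $\omega$, $E^*_{i,\omega}$ ($i=0,1,2$) is the diagonal matrix whose diagonal is the $\omega$-row of $A_i$; $T_\omega$ is the algebra generated by $A_0,A_1,A_2,E^*_{0,\omega},E^*_{1,\omega},E^*_{2,\omega}$; $T_{0,\omega}$ is the span of all $E^*_{i,\omega}A_jE^*_{k,\omega}$; $\tilde T_\omega$ is the algebra of complex matrices commuting with the permutation matrices of the stabilizer $G_\omega$ in $G=\mathrm{Aut}(\Gamma)$. $\Gamma$ is triply transitive if $G$ is transitive and $T_{0,\omega}=T_\omega=\tilde T_\omega$ for some (equivalently every) vertex $\omega$.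
   Formalization: The five parameter sets (p,e,ℓ) = (2,3,1), (2,3,2), (2,5,1), (5,3,1), (3,5,1) are excluded: these graphs (2K₂, Clebsch, 4K₄, the 5×5 and 9×9 rook graphs) are triply transitive, so the claim fails for them. *)

theory Defs
  imports "HOL-Analysis.Analysis" "HOL-Number_Theory.Number_Theory"
begin

text \<open>
  A graph is given by its adjacency relation on a finite type of vertices, and the complex
  matrices with rows and columns indexed by the vertices are the elements of
  \<^typ>\<open>complex ^ 'v ^ 'v\<close>.
\<close>

text \<open>
  The scaling of \<^typ>\<open>complex ^ 'v ^ 'v\<close> supplied by its type class is only the real one, so
  complex scaling, and with it the complex linear span, is introduced here.
\<close>

definition cscale :: "complex \<Rightarrow> complex ^ 'v ^ 'v \<Rightarrow> complex ^ 'v ^ 'v" where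
  "cscale c M = (\<chi> x y. c * M $ x $ y)"

global_interpretation cmat: vector_space "cscale :: complex \<Rightarrow> complex ^ 'v ^ 'v \<Rightarrow> _"
  by unfold_locales (simp_all add: cscale_def vec_eq_iff algebra_simps)

definition subalgebra :: "(complex ^ 'v ^ 'v) set \<Rightarrow> bool" where
  "subalgebra S \<longleftrightarrow> cmat.subspace S \<and> (\<forall>M\<in>S. \<forall>N\<in>S. M ** N \<in> S)"

definition adj_matrix :: "('v \<Rightarrow> 'v \<Rightarrow> bool) \<Rightarrow> complex ^ 'v ^ 'v" where
  "adj_matrix E = (\<chi> x y. if E x y then 1 else 0)"

definition all_ones :: "complex ^ 'v ^ 'v" where
  "all_ones = (\<chi> x y. 1)"

text \<open>The matrices $A_0$, $A_1$, $A_2$; only the indices 0, 1, 2 are ever used.\<close>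

definition A_mat :: "('v::finite \<Rightarrow> 'v \<Rightarrow> bool) \<Rightarrow> nat \<Rightarrow> complex ^ 'v ^ 'v" where
  "A_mat E i =
    (if i = 0 then mat 1
     else if i = 1 then adj_matrix E
     else all_ones - mat 1 - adj_matrix E)"

definition Estar :: "('v::finite \<Rightarrow> 'v \<Rightarrow> bool) \<Rightarrow> 'v \<Rightarrow> nat \<Rightarrow> complex ^ 'v ^ 'v" where
  "Estar E \<omega> i = (\<chi> x y. if x = y then A_mat E i $ \<omega> $ x else 0)"

text \<open>$T_\omega$. The generators include the identity, so the hull is a unital algebra.\<close>

definition terwilliger_algebra :: "('v::finite \<Rightarrow> 'v \<Rightarrow> bool) \<Rightarrow> 'v \<Rightarrow> (complex ^ 'v ^ 'v) set" where
  "terwilliger_algebra E \<omega> = subalgebra hull (A_mat E ` {0, 1, 2} \<union> Estar E \<omega> ` {0, 1, 2})"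

text \<open>$T_{0,\omega}$\<close>

definition terwilliger_span :: "('v::finite \<Rightarrow> 'v \<Rightarrow> bool) \<Rightarrow> 'v \<Rightarrow> (complex ^ 'v ^ 'v) set" where
  "terwilliger_span E \<omega> =
    cmat.span {Estar E \<omega> i ** A_mat E j ** Estar E \<omega> k | i j k.
                 i \<in> {0, 1, 2} \<and> j \<in> {0, 1, 2} \<and> k \<in> {0, 1, 2}}"

definition graph_aut :: "('v \<Rightarrow> 'v \<Rightarrow> bool) \<Rightarrow> ('v \<Rightarrow> 'v) set" where
  "graph_aut E = {\<pi>. bij \<pi> \<and> (\<forall>x y. E (\<pi> x) (\<pi> y) \<longleftrightarrow> E x y)}"

definition perm_matrix :: "('v \<Rightarrow> 'v) \<Rightarrow> complex ^ 'v ^ 'v" where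
  "perm_matrix \<pi> = (\<chi> x y. if x = \<pi> y then 1 else 0)"

text \<open>$\tilde T_\omega$\<close>

definition stabilizer_centralizer ::
  "('v::finite \<Rightarrow> 'v \<Rightarrow> bool) \<Rightarrow> 'v \<Rightarrow> (complex ^ 'v ^ 'v) set" where
  "stabilizer_centralizer E \<omega> =
    {M. \<forall>\<pi>\<in>graph_aut E. \<pi> \<omega> = \<omega> \<longrightarrow> M ** perm_matrix \<pi> = perm_matrix \<pi> ** M}"

definition vertex_transitive :: "('v \<Rightarrow> 'v \<Rightarrow> bool) \<Rightarrow> bool" where
  "vertex_transitive E \<longleftrightarrow> (\<forall>x y. \<exists>\<pi>\<in>graph_aut E. \<pi> x = y)"

definition triply_transitive :: "('v::finite \<Rightarrow> 'v \<Rightarrow> bool) \<Rightarrow> bool" where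
  "triply_transitive E \<longleftrightarrow>
    vertex_transitive E \<and>
    (\<exists>\<omega>. terwilliger_span E \<omega> = terwilliger_algebra E \<omega> \<and>
         terwilliger_algebra E \<omega> = stabilizer_centralizer E \<omega>)"

definition vLS_adj :: "nat \<Rightarrow> 'a::field \<Rightarrow> 'a \<Rightarrow> bool" where
  "vLS_adj e x y \<longleftrightarrow> x - y \<in> {z ^ e | z. z \<noteq> 0}"

text \<open>
  The parameters $(p, e, \ell)$ of the five van Lint--Schrijver graphs that are triply transitive:
  $2K_2$ ($q = 4$), the Clebsch graph of valency 5 ($q = 16$, $e = 3$), $4K_4$
  ($q = 16$, $e = 5$), and the $5 \times 5$ and $9 \times 9$ rook's graphs ($q = 25$, $q = 81$).
\<close>

definition small_vLS_parameters :: "(nat \<times> nat \<times> nat) set" where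
  "small_vLS_parameters = {(2, 3, 1), (2, 3, 2), (2, 5, 1), (5, 3, 1), (3, 5, 1)}"

end

theory Submission
  imports Defs
begin

text \<open>
  Only the equality $T_{0,\omega} = T_\omega$ is needed. It makes the graph triply regular: the number
  of common neighbours of three vertices depends only on their mutual relations. With $0$ as one of the
  vertices, $D = K \cap (K + 1)$ is therefore a partial difference set in the cyclic group $K$. By
  Schur's argument, unless $|K|$ is prime, $D \cup \{1\}$ or $K - D$ is a subgroup of $K$.

  Since $p$ is a primitive root modulo $e$, the Frobenius map permutes the nontrivial cosets of $K$
  transitively, so the Gaussian periods take only two values, and their first three moments give an
  integer $\eta$ with $q = (e\eta + 1)^2$, $|K| = \eta(e\eta + 2)$ and $|D| = \eta^2 - (e-3)\eta - 1$.
  If $|K|$ is prime, or if $|K - D|$ divides $|K|$, then $\eta = \pm 1$. If $D \cup \{1\}$ is a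
  subgroup, the common neighbours of $0$, $1$ and a vertex adjacent to neither are counted on average,
  and integrality gives $(e-1)\eta + 1 \mid (2e-3)(e-2)$. As $|e\eta + 1| \ge 2^{(e-1)/2}$, both
  conclusions leave only the small parameters.
\<close>

section \<open>Partial difference sets in multiplicative groups\<close>

text \<open>In group ring terms, the sets {1}, D and K - D - {1} span a Schur ring of rank 3 over K,
  and the dichotomy is the rank 3 case of Schur's theorem that over a cyclic group of composite
  order a primitive Schur ring is trivial. Its two outcomes describe the graph induced on the
  neighbours of 0: a disjoint union of cliques if D with 1 is a subgroup, a complete multipartite
  graph if K - D is one. The clique outcome does occur: for p = 2, e = 5, \<ell> = 2 the set D with
  1 is the multiplicative group of the field with four elements. Schur's theorem and Lagrange's
  theorem therefore cannot finish the proof, and triple regularity is used a second time, at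
  vertices outside the neighbourhoods of 0 and 1. The third moment enters because |K| |D| is the
  number of solutions of x + y + z = 0 in K. The constant (2e - 3)(e - 2) is, up to sign, what
  remains of a cubic in \<eta>, after clearing denominators, when (e - 1) \<eta> is replaced by
  -1.\<close>

definition mult_subgroup :: "'a::field set \<Rightarrow> bool" where
  "mult_subgroup H \<longleftrightarrow> 0 \<notin> H \<and> 1 \<in> H \<and> (\<forall>x\<in>H. \<forall>y\<in>H. x / y \<in> H)"

lemma mult_subgroupD:
  assumes "mult_subgroup H"
  shows "0 \<notin> H" "1 \<in> H" "x \<in> H \<Longrightarrow> y \<in> H \<Longrightarrow> x / y \<in> H"
    "x \<in> H \<Longrightarrow> inverse x \<in> H" "x \<in> H \<Longrightarrow> y \<in> H \<Longrightarrow> x * y \<in> H"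
    "x \<in> H \<Longrightarrow> x ^ n \<in> H"
proof -
  show 0: "0 \<notin> H" and 1: "1 \<in> H" and div: "\<And>x y. x \<in> H \<Longrightarrow> y \<in> H \<Longrightarrow> x / y \<in> H"
    using assms by (auto simp: mult_subgroup_def)
  show inv: "\<And>x. x \<in> H \<Longrightarrow> inverse x \<in> H"
    using div[OF 1] by (simp add: inverse_eq_divide)
  show mul: "\<And>x y. x \<in> H \<Longrightarrow> y \<in> H \<Longrightarrow> x * y \<in> H"
    using div[OF _ inv] by (simp add: divide_inverse)
  show "x \<in> H \<Longrightarrow> x ^ n \<in> H"
    by (induction n) (use 1 mul in auto)
qed

lemma mult_subgroup_coset:
  assumes "mult_subgroup H" "h \<in> H"
  shows "(*) h ` H = H"
proof
  show "(*) h ` H \<subseteq> H"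
    using mult_subgroupD[OF assms(1)] assms(2) by auto
  show "H \<subseteq> (*) h ` H"
  proof
    fix x assume "x \<in> H"
    then have "x / h \<in> H" "x = h * (x / h)"
      using mult_subgroupD[OF assms(1)] assms(2) by auto
    then show "x \<in> (*) h ` H" by blast
  qed
qed

lemma mem_times_image_iff: "g \<noteq> 0 \<Longrightarrow> x \<in> (*) g ` A \<longleftrightarrow> x / g \<in> A" for g :: "'a::field"
  by (auto simp: image_iff intro!: bexI[of _ "x / g"])

lemma card_times_image: "g \<noteq> 0 \<Longrightarrow> card ((*) g ` A) = card A" for g :: "'a::field"
  by (simp add: card_image inj_on_def)

definition partial_difference_set :: "'a::field set \<Rightarrow> 'a set \<Rightarrow> bool" where
  "partial_difference_set K D \<longleftrightarrow>
     D \<subseteq> K - {1} \<and> (\<forall>x\<in>D. inverse x \<in> D) \<and>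
     (\<exists>a. \<forall>g\<in>D. card (D \<inter> (*) g ` D) = a) \<and>
     (\<exists>b. \<forall>g\<in>K - D - {1}. card (D \<inter> (*) g ` D) = b)"

text \<open>The complement of a strongly regular graph is strongly regular; inclusion-exclusion
  expresses the new intersection sizes through the old ones.\<close>

lemma pds_compl:
  assumes K: "mult_subgroup K" "finite K" and pds: "partial_difference_set K D"
  shows "partial_difference_set K (K - D - {1})"
proof -
  note K' = mult_subgroupD[OF K(1)]
  let ?D' = "K - D - {1}"
  obtain a b where a: "\<And>g. g \<in> D \<Longrightarrow> card (D \<inter> (*) g ` D) = a"
    and b: "\<And>g. g \<in> ?D' \<Longrightarrow> card (D \<inter> (*) g ` D) = b"
    using pds unfolding partial_difference_set_def by metis
  have D: "D \<subseteq> K" "1 \<notin> D" and Dinv: "\<And>x. x \<in> D \<Longrightarrow> inverse x \<in> D"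
    using pds by (auto simp: partial_difference_set_def)
  have finD: "finite D" using D K(2) finite_subset by blast
  have Dinv_iff: "inverse x \<in> D \<longleftrightarrow> x \<in> D" for x using Dinv[of x] Dinv[of "inverse x"] by auto
  have shift: "?D' \<inter> (*) g ` ?D' = K - (D \<union> (*) g ` D \<union> {1, g})" if "g \<in> K" for g
  proof -
    have [simp]: "g \<noteq> 0" using that K' by auto
    have "x / g \<in> K" if "x \<in> K" for x using that \<open>g \<in> K\<close> K' by auto
    then show ?thesis by (auto simp: mem_times_image_iff)
  qed
  have card_un: "card (D \<union> (*) g ` D) = 2 * card D - card (D \<inter> (*) g ` D)" if "g \<in> K" for g
  proof -
    have [simp]: "g \<noteq> 0" using that K' by auto
    show ?thesis using card_Un_Int[of D "(*) g ` D"] finD by (simp add: card_times_image)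
  qed
  have sub: "D \<union> (*) g ` D \<union> {1, g} \<subseteq> K" if "g \<in> K" for g
    using that K' D by auto
  have fin: "finite (D \<union> (*) g ` D \<union> {1, g})" for g using finD by auto
  have mem: "1 \<in> (*) g ` D \<longleftrightarrow> g \<in> D" "g \<notin> (*) g ` D" if "g \<in> K" for g
  proof -
    have "g \<noteq> 0" using that K' by auto
    then show "1 \<in> (*) g ` D \<longleftrightarrow> g \<in> D" "g \<notin> (*) g ` D"
      using D Dinv_iff[of g] by (simp_all add: mem_times_image_iff inverse_eq_divide)
  qed
  have "card (?D' \<inter> (*) g ` ?D') = card K - (2 * card D - a)" if "g \<in> D" for g
  proof -
    have g: "g \<in> K" using that D by auto
    have "D \<union> (*) g ` D \<union> {1, g} = D \<union> (*) g ` D" using mem(1)[OF g] that by auto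
    then show ?thesis
      using card_Diff_subset[OF fin sub[OF g]] card_un[OF g] a[OF that] shift[OF g] by simp
  qed
  moreover have "card (?D' \<inter> (*) g ` ?D') = card K - (2 * card D - b + 2)" if "g \<in> ?D'" for g
  proof -
    have g: "g \<in> K" "g \<notin> D" "g \<noteq> 1" using that D by auto
    \<comment> \<open>Here 1 and g are two new elements. For g in D both already lie in D \<union>
      gD, because 1 = g * inverse g.\<close>
    have "card (D \<union> (*) g ` D \<union> {1, g}) = card (insert 1 (insert g (D \<union> (*) g ` D)))"
      by (rule arg_cong[where f = card]) auto
    also have "\<dots> = Suc (Suc (card (D \<union> (*) g ` D)))"
      using mem[OF g(1)] g D finD by (simp add: card_insert_if)
    finally show ?thesis
      using card_Diff_subset[OF fin sub[OF g(1)]] card_un[OF g(1)] b[OF that] shift[OF g(1)] by simp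
  qed
  moreover have "?D' \<subseteq> K - {1}" by auto
  moreover have "\<forall>x\<in>?D'. inverse x \<in> ?D'"
    using Dinv_iff K' by auto
  moreover have "K - ?D' - {1} = D" using D by auto
  ultimately show ?thesis unfolding partial_difference_set_def by (simp only:) blast
qed

text \<open>One disjoint translate makes the second parameter 0. If h = x / y with x, y in D were
  neither 1 nor in D, then x would lie in D \<inter> hD.\<close>

lemma pds_subgroup_of_disjoint_translate:
  assumes K: "mult_subgroup K" "finite K" and pds: "partial_difference_set K D"
    and g: "g \<in> K - D - {1}" and disj: "D \<inter> (*) g ` D = {}"
  shows "mult_subgroup (insert 1 D)"
proof -
  note K' = mult_subgroupD[OF K(1)]
  have D: "D \<subseteq> K" "1 \<notin> D" and Dinv: "\<And>x. x \<in> D \<Longrightarrow> inverse x \<in> D"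
    using pds by (auto simp: partial_difference_set_def)
  have finD: "finite D" using D K(2) finite_subset by blast
  have empty: "D \<inter> (*) h ` D = {}" if "h \<in> K - D - {1}" for h
  proof -
    have "card (D \<inter> (*) h ` D) = card (D \<inter> (*) g ` D)"
      using pds g that unfolding partial_difference_set_def by metis
    then show ?thesis using disj finD by simp
  qed
  have "x / y \<in> insert 1 D" if "x \<in> D" "y \<in> D" for x y
  proof (rule ccontr)
    assume "x / y \<notin> insert 1 D"
    moreover have "x / y \<in> K" using K'(3) that D(1) by (meson subsetD)
    ultimately have "x / y \<in> K - D - {1}" by blast
    moreover have "y \<noteq> 0" using that D(1) K'(1) by auto
    then have "x \<in> (*) (x / y) ` D"
      using that by (auto intro!: image_eqI[of _ _ y])
    ultimately show False using empty that(1) by blast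
  qed
  then show ?thesis
    using D Dinv K'(1) unfolding mult_subgroup_def by (auto simp: inverse_eq_divide)
qed

text \<open>For g in K outside H, the sets D and gD lie in the distinct cosets H and gH, so they are
  disjoint.\<close>

lemma pds_subgroup_of_proper:
  assumes K: "mult_subgroup K" "finite K" and pds: "partial_difference_set K D"
    and H: "mult_subgroup H" "D \<subseteq> H" "H \<subset> K"
  shows "mult_subgroup (insert 1 D)"
proof -
  note H' = mult_subgroupD[OF H(1)]
  obtain g where g: "g \<in> K" "g \<notin> H" using H by auto
  then have g0: "g \<noteq> 0" using mult_subgroupD[OF K(1)] by auto
  have "x / g \<notin> D" if x: "x \<in> D" for x
  proof
    assume "x / g \<in> D"
    then have "x / (x / g) \<in> H" using H'(3) x H(2) by (meson subsetD)
    moreover have "x \<noteq> 0" using x H(2) H'(1) by auto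
    ultimately show False using g g0 by simp
  qed
  then have "D \<inter> (*) g ` D = {}" using mem_times_image_iff[OF g0] by blast
  moreover have "g \<in> K - D - {1}" using g H H' by auto
  ultimately show ?thesis using pds_subgroup_of_disjoint_translate[OF K pds] by blast
qed

text \<open>Dual to the disjoint case: the second parameter is now |D|, so gD = D for every g in K -
  D, and K - D is the stabilizer of D.\<close>

lemma pds_subgroup_of_stabilizer:
  assumes K: "mult_subgroup K" "finite K" and pds: "partial_difference_set K D"
    and h: "h \<in> K - D - {1}" "(*) h ` D = D"
  shows "mult_subgroup (K - D)"
proof -
  note K' = mult_subgroupD[OF K(1)]
  have D: "D \<subseteq> K" "1 \<notin> D" and Dinv: "\<And>x. x \<in> D \<Longrightarrow> inverse x \<in> D"
    using pds by (auto simp: partial_difference_set_def)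
  have finD: "finite D" using D K(2) finite_subset by blast
  have stab: "(*) g ` D = D" if g: "g \<in> K - D" for g
  proof (cases "g = 1")
    case False
    have "card (D \<inter> (*) g ` D) = card (D \<inter> (*) h ` D)"
      using pds g h False unfolding partial_difference_set_def by (metis DiffI singletonD)
    then have "card (D \<inter> (*) g ` D) = card D" using h by simp
    then have "D \<inter> (*) g ` D = D" using finD by (simp add: card_subset_eq)
    moreover have "g \<noteq> 0" using g K' by auto
    ultimately show ?thesis
      using finD card_times_image[of g D] by (metis card_subset_eq finite_imageI inf_le2)
  qed auto
  have "x / y \<in> K - D" if "x \<in> K - D" "y \<in> K - D" for x y
  proof (rule ccontr)
    assume "x / y \<notin> K - D"
    then have "x / y \<in> D" using that K' by auto
    then have "y * (x / y) \<in> D" using stab[of y] that by blast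
    moreover have "y \<noteq> 0" using that K' by blast
    ultimately show False using that by simp
  qed
  then show ?thesis using D K' unfolding mult_subgroup_def by blast
qed

section \<open>Powers of D in the group ring, and Schur's argument\<close>

text \<open>The coefficient of g in the n-th power of the sum of D in the integral group ring: for D
  without 0, the number of n-tuples from D with product g.\<close>

fun convolution_power :: "'a::field set \<Rightarrow> nat \<Rightarrow> 'a \<Rightarrow> int" where
  "convolution_power D 0 g = of_bool (g = 1)"
| "convolution_power D (Suc n) g = (\<Sum>x\<in>D. convolution_power D n (g / x))"

lemma convolution_power_empty: "n > 0 \<Longrightarrow> convolution_power {} n g = 0"
  by (cases n) auto

text \<open>The binomial theorem in the commutative group ring; i is the number of factors equal to
  x.\<close>

lemma convolution_power_insert:
  assumes "finite D" "x \<notin> D"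
  shows "convolution_power (insert x D) n g =
    (\<Sum>i\<le>n. int (n choose i) * convolution_power D (n - i) (g / x ^ i))"
proof (induction n arbitrary: g)
  case (Suc n)
  let ?c = "convolution_power D" and ?d = "convolution_power (insert x D)"
  have "?d (Suc n) g = ?d n (g / x) + (\<Sum>y\<in>D. ?d n (g / y))"
    using assms by simp
  also have "?d n (g / x) = (\<Sum>i\<le>n. int (n choose i) * ?c (Suc n - Suc i) (g / x ^ Suc i))"
    by (simp add: Suc)
  also have "(\<Sum>y\<in>D. ?d n (g / y)) = (\<Sum>i\<le>n. int (n choose i) * ?c (Suc n - i) (g / x ^ i))"
  proof -
    have "(\<Sum>y\<in>D. ?d n (g / y)) = (\<Sum>i\<le>n. int (n choose i) * (\<Sum>y\<in>D. ?c (n - i) (g / y / x ^ i)))"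
      by (simp add: Suc sum_distrib_left) (rule sum.swap)
    also have "\<dots> = (\<Sum>i\<le>n. int (n choose i) * ?c (Suc n - i) (g / x ^ i))"
      by (intro sum.cong) (simp_all add: Suc_diff_le divide_divide_eq_left mult.commute)
    finally show ?thesis .
  qed
  also have "(\<Sum>i\<le>n. int (n choose i) * ?c (Suc n - i) (g / x ^ i)) =
      (\<Sum>i\<le>Suc n. int (n choose i) * ?c (Suc n - i) (g / x ^ i))"
    by simp
  also have "\<dots> = ?c (Suc n) g + (\<Sum>i\<le>n. int (n choose Suc i) * ?c (Suc n - Suc i) (g / x ^ Suc i))"
    by (subst sum.atMost_Suc_shift) simp
  finally show ?case
    by (subst sum.atMost_Suc_shift) (simp add: sum.distrib algebra_simps)
qed simp

text \<open>The freshman's dream in the group ring modulo r: the r-th power of the sum of D is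
  congruent to the sum of the r-th powers of its elements.\<close>

lemma convolution_power_prime:
  assumes "prime r" "finite D" "0 \<notin> D"
  shows "[convolution_power D r g = int (card {x \<in> D. x ^ r = g})] (mod int r)"
  using assms(2,3)
proof (induction D arbitrary: g)
  case empty
  then show ?case using prime_gt_0_nat[OF assms(1)] by (simp add: convolution_power_empty)
next
  case (insert x D)
  let ?f = "\<lambda>i. int (r choose i) * convolution_power D (r - i) (g / x ^ i)"
  have r: "r > 0" using prime_gt_0_nat[OF assms(1)] by simp
  have "convolution_power (insert x D) r g = (\<Sum>i\<le>r. ?f i)"
    using insert by (intro convolution_power_insert) auto
  also have "\<dots> = ?f 0 + ?f r + (\<Sum>i\<in>{..r} - {0, r}. ?f i)"
    using r by (subst sum.subset_diff[of "{0, r}"]) auto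
  also have "[\<dots> = ?f 0 + ?f r + 0] (mod int r)"
  proof (intro cong_add cong_refl)
    have "int r dvd ?f i" if "i \<in> {..r} - {0, r}" for i
      using dvd_choose_prime[of i r] that assms(1) r by (intro dvd_mult2) auto
    then show "[(\<Sum>i\<in>{..r} - {0, r}. ?f i) = 0] (mod int r)"
      by (auto simp: cong_0_iff intro!: dvd_sum)
  qed
  also have "?f 0 + ?f r + 0 = convolution_power D r g + of_bool (x ^ r = g)"
    using insert by auto
  also have "[\<dots> = int (card {x \<in> D. x ^ r = g}) + of_bool (x ^ r = g)] (mod int r)"
    using insert by (intro cong_add cong_refl insert.IH) auto
  also have "int (card {x \<in> D. x ^ r = g}) + of_bool (x ^ r = g) = int (card {y \<in> insert x D. y ^ r = g})"
  proof -
    have "{y \<in> insert x D. y ^ r = g} =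
        (if x ^ r = g then insert x {y \<in> D. y ^ r = g} else {y \<in> D. y ^ r = g})" by auto
    then show ?thesis using insert by auto
  qed
  finally show ?case .
qed

text \<open>The span of 1, D and K - D - {1} in the group ring is closed under multiplication by D,
  so it contains all powers of D.\<close>

lemma convolution_power_const:
  assumes K: "mult_subgroup K" "finite K" and pds: "partial_difference_set K D"
  shows "\<exists>a b. (\<forall>g\<in>D. convolution_power D n g = a) \<and> (\<forall>g\<in>K - D - {1}. convolution_power D n g = b)"
proof (induction n)
  case 0
  have "1 \<notin> D" using pds by (auto simp: partial_difference_set_def)
  then show ?case by (intro exI[of _ 0]) auto
next
  case (Suc n)
  note K' = mult_subgroupD[OF K(1)]
  have D: "D \<subseteq> K" "1 \<notin> D" and Dinv: "\<And>x. x \<in> D \<Longrightarrow> inverse x \<in> D"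
    using pds by (auto simp: partial_difference_set_def)
  have finD: "finite D" using D K(2) finite_subset by blast
  have Dinv_iff: "inverse x \<in> D \<longleftrightarrow> x \<in> D" for x using Dinv[of x] Dinv[of "inverse x"] by auto
  let ?f = "convolution_power D n"
  obtain a b where ab: "\<And>g. g \<in> D \<Longrightarrow> ?f g = a" "\<And>g. g \<in> K - D - {1} \<Longrightarrow> ?f g = b"
    using Suc by metis
  obtain u v where u: "\<And>g. g \<in> D \<Longrightarrow> card (D \<inter> (*) g ` D) = u"
    and v: "\<And>g. g \<in> K - D - {1} \<Longrightarrow> card (D \<inter> (*) g ` D) = v"
    using pds unfolding partial_difference_set_def by metis
  have main: "convolution_power D (Suc n) g =
      ?f 1 * of_bool (g \<in> D) + a * int (card (D \<inter> (*) g ` D)) +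
      b * (int (card D) - of_bool (g \<in> D) - int (card (D \<inter> (*) g ` D)))" if g: "g \<in> K" for g
  proof -
    have g0: "g \<noteq> 0" using g K' by auto
    \<comment> \<open>As D is closed under inverses, g / x is in D exactly if x is in gD. The
      summands are thus sorted by whether g / x is 1, in D or elsewhere.\<close>
    have eq: "?f (g / x) = b + (?f 1 - b) * of_bool (x = g) + (a - b) * of_bool (x \<in> (*) g ` D)"
      if x: "x \<in> D" for x
    proof -
      have "x \<in> K" using x D by auto
      then have x0: "x \<noteq> 0" and gx: "g / x \<in> K" using K' g by auto
      have 1: "x = g \<longleftrightarrow> g / x = 1" using x0 by auto
      have "x / g \<in> D \<longleftrightarrow> g / x \<in> D" using Dinv_iff[of "x / g"] by simp
      then have 2: "x \<in> (*) g ` D \<longleftrightarrow> g / x \<in> D" using g0 by (simp add: mem_times_image_iff)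
      show ?thesis
      proof (cases "g / x = 1")
        case True
        then show ?thesis using D unfolding 1 2 by simp
      next
        case False
        then show ?thesis
          using ab(1)[of "g / x"] ab(2)[of "g / x"] gx unfolding 1 2 by (cases "g / x \<in> D") simp_all
      qed
    qed
    have "convolution_power D (Suc n) g =
      (\<Sum>x\<in>D. b + (?f 1 - b) * of_bool (x = g) + (a - b) * of_bool (x \<in> (*) g ` D))"
      using eq by simp
    also have "\<dots> = int (card D) * b + (?f 1 - b) * (\<Sum>x\<in>D. of_bool (x = g))
        + (a - b) * (\<Sum>x\<in>D. of_bool (x \<in> (*) g ` D))"
      by (simp add: sum.distrib sum_distrib_left)
    also have "(\<Sum>x\<in>D. of_bool (x \<in> (*) g ` D)) = int (card (D \<inter> (*) g ` D))"
      using finD by (simp add: of_bool_def sum.If_cases)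
    also have "(\<Sum>x\<in>D. of_bool (x = g)) = (of_bool (g \<in> D) :: int)"
      using finD by (simp add: of_bool_def)
    finally show ?thesis by (simp add: algebra_simps)
  qed
  have "convolution_power D (Suc n) g = ?f 1 + a * int u + b * (int (card D) - 1 - int u)"
    if "g \<in> D" for g
    using main[of g] that u[OF that] D by auto
  moreover have "convolution_power D (Suc n) g = a * int v + b * (int (card D) - int v)"
    if "g \<in> K - D - {1}" for g
    using main[of g] that v[OF that] by simp
  ultimately show ?case by blast
qed

text \<open>Outside P, the set D is a union of cosets of P. All |D - gD| with g in D agree. For g =
  u this difference contains u(P - D); for g = h it is contained in P - hD, which has the same size
  |P - D|. Hence D - hD = P - hD, and an element h' of P - D has to lie in hD.\<close>

lemma pds_saturated_quotient:
  assumes P: "mult_subgroup P" "finite P"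
    and D: "finite D" "0 \<notin> D" "\<And>g. g \<in> D \<Longrightarrow> card (D \<inter> (*) g ` D) = a"
    and sat: "\<And>x h. x \<in> D \<Longrightarrow> x \<notin> P \<Longrightarrow> h \<in> P \<Longrightarrow> x * h \<in> D"
    and u: "u \<in> D" "u \<notin> P" and h: "h \<in> D" "h \<in> P" and h': "h' \<in> P" "h' \<notin> D"
  shows "h' / h \<in> D"
proof -
  note P' = mult_subgroupD[OF P(1)]
  have 0: "u \<noteq> 0" "h \<noteq> 0" using u h D by auto
  have card_diff: "card (D - (*) g ` D) = card D - a" if "g \<in> D" for g
    using D(3)[OF that] card_Diff_subset_Int[of D "(*) g ` D"] D(1) by simp
  have "card (P - (*) h ` D) = card ((*) h ` P - (*) h ` D)"
    using mult_subgroup_coset[OF P(1) h(2)] by simp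
  also have "(*) h ` P - (*) h ` D = (*) h ` (P - D)"
    using 0 by (simp add: image_set_diff inj_on_def)
  also have "card \<dots> = card ((*) u ` (P - D))"
    using 0 by (simp add: card_times_image)
  also have "\<dots> \<le> card (D - (*) u ` D)"
    using D(1) 0 sat[OF u] by (intro card_mono) (auto simp: mem_times_image_iff)
  also have "\<dots> = card (D - (*) h ` D)"
    using card_diff u h by simp
  finally have le: "card (P - (*) h ` D) \<le> card (D - (*) h ` D)" .
  have "D - (*) h ` D \<subseteq> P - (*) h ` D"
  proof
    fix x assume x: "x \<in> D - (*) h ` D"
    have "x \<in> P"
    proof (rule ccontr)
      assume "x \<notin> P"
      then have "x * inverse h \<in> D" using x sat P'(4)[OF h(2)] by blast
      then show False using x 0 by (simp add: mem_times_image_iff divide_inverse)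
    qed
    then show "x \<in> P - (*) h ` D" using x by blast
  qed
  then have "D - (*) h ` D = P - (*) h ` D"
    using le P(2) by (meson card_seteq finite_Diff)
  then have "h' \<in> (*) h ` D" using h' by blast
  then show ?thesis using 0 by (simp add: mem_times_image_iff)
qed

text \<open>Schur's argument. Raising to the \<open>r\<close>-th power maps the coset \<open>x P\<close> to a single point, and
  modulo \<open>r\<close> the number of preimages in \<open>D\<close> of a point is a coefficient of the \<open>r\<close>-th power of
  \<open>D\<close> in the group ring, hence constant on \<open>D\<close> and on its complement.\<close>

lemma pds_subgroup:
  assumes K: "mult_subgroup K" "finite K" and pds: "partial_difference_set K D"
    and r: "prime r" "card {x \<in> K. x ^ r = 1} = r" "{x \<in> K. x ^ r = 1} \<noteq> K"
  shows "mult_subgroup (insert 1 D) \<or> mult_subgroup (K - D)"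
proof -
  note K' = mult_subgroupD[OF K(1)]
  have D: "D \<subseteq> K" "1 \<notin> D" and Dinv: "\<And>x. x \<in> D \<Longrightarrow> inverse x \<in> D"
    using pds by (auto simp: partial_difference_set_def)
  have finD: "finite D" using D K(2) finite_subset by blast
  have D0: "0 \<notin> D" using D(1) K'(1) by auto
  define D' where "D' = K - D - {1}"
  have pds': "partial_difference_set K D'"
    using pds_compl[OF K pds] by (simp add: D'_def)
  have D'_eqs: "insert 1 D' = K - D" "K - D' = insert 1 D"
    using D K'(2) by (auto simp: D'_def)
  define P where "P = {x \<in> K. x ^ r = 1}"
  have P: "mult_subgroup P" "finite P" "P \<subset> K" "card P = r"
    using K' K(2) r by (auto simp: P_def mult_subgroup_def power_divide)
  note P' = mult_subgroupD[OF P(1)]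
  have "r \<ge> 2" using r(1) by (rule prime_ge_2_nat)
  then obtain h0 where h0: "h0 \<in> P" "h0 \<noteq> 1"
    using P(4) card_2_iff'[of P] P'(2) P(2)
    by (metis card_le_Suc0_iff_eq le_trans not_less_eq_eq numeral_2_eq_2)
  define R where "R = (\<lambda>x. x ^ r) ` K"
  have R: "mult_subgroup R"
    unfolding mult_subgroup_def
  proof (intro conjI ballI)
    show "0 \<notin> R" "1 \<in> R" using K'(1,2) by (auto simp: R_def image_iff intro!: bexI[of _ 1])
    fix x y assume "x \<in> R" "y \<in> R"
    then obtain x' y' where "x = x' ^ r" "y = y' ^ r" "x' \<in> K" "y' \<in> K" by (auto simp: R_def)
    then show "x / y \<in> R" unfolding R_def
      by (intro image_eqI[of _ _ "x' / y'"]) (simp_all add: power_divide K'(3))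
  qed
  have "R \<noteq> K"
  proof
    assume "R = K"
    then have "inj_on (\<lambda>x. x ^ r) K"
      unfolding R_def by (intro eq_card_imp_inj_on) (use K(2) in simp_all)
    then have "h0 = 1" using h0 K'(2) by (auto simp: P_def inj_on_def)
    then show False using h0 by simp
  qed
  moreover have "R \<subseteq> K" using K'(6) by (auto simp: R_def)
  ultimately have RK: "R \<subset> K" by blast
  define c where "c g = card {x \<in> D. x ^ r = g}" for g
  have c_R: "g \<in> R" if "\<not> r dvd c g" for g
  proof (rule ccontr)
    assume "g \<notin> R"
    then have "{x \<in> D. x ^ r = g} = {}" using D by (auto simp: R_def)
    then have "c g = 0" by (simp only: c_def card.empty)
    then show False using that by simp
  qed
  obtain a b where ab: "\<And>g. g \<in> D \<Longrightarrow> convolution_power D r g = a"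
      "\<And>g. g \<in> D' \<Longrightarrow> convolution_power D r g = b"
    using convolution_power_const[OF K pds, of r] unfolding D'_def by metis
  have c: "r dvd c g \<longleftrightarrow> int r dvd convolution_power D r g" for g
    using convolution_power_prime[OF r(1) finD D0, of g] unfolding c_def
    by (metis cong_dvd_iff int_dvd_int_iff)
  show ?thesis
  \<comment> \<open>Modulo r, \<open>c\<close> is constant on D and on \<open>D'\<close>. A nonzero
    value on one of them puts that whole set into the proper subgroup \<open>R\<close> of r-th
    powers.\<close>
  proof (cases "(\<exists>g\<in>D. \<not> r dvd c g) \<or> (\<exists>g\<in>D'. \<not> r dvd c g)")
    case True
    then have "D \<subseteq> R \<or> D' \<subseteq> R" using c ab c_R by (metis subsetI)
    then show ?thesis
      using pds_subgroup_of_proper[OF K pds R _ RK] pds_subgroup_of_proper[OF K pds' R _ RK] D'_eqs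
      by auto
  next
    case False
    \<comment> \<open>The fibre D \<inter> xP has size divisible by r = |P|, so it is empty or all
      of xP. Elements of P are left out: their r-th power is 1, where \<open>c\<close> is not
      controlled.\<close>
    have sat: "x * h \<in> D" if x: "x \<in> D" "x \<notin> P" and h: "h \<in> P" for x h
    proof -
      have x0: "x \<noteq> 0" and xK: "x \<in> K" using x D D0 by auto
      have "x ^ r \<in> K" "x ^ r \<noteq> 1" using x xK K'(6) by (auto simp: P_def)
      then have "x ^ r \<in> D \<or> x ^ r \<in> D'" by (auto simp: D'_def)
      then have dvd: "r dvd c (x ^ r)" using False by blast
      have "{y \<in> D. y ^ r = x ^ r} = D \<inter> (*) x ` P"
        using x0 xK D(1) K'(3)
        by (auto simp: mem_times_image_iff P_def power_divide power_mult_distrib)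
      then have c: "c (x ^ r) = card (D \<inter> (*) x ` P)" by (simp add: c_def)
      have "x \<in> D \<inter> (*) x ` P" using x P'(2) by (auto intro!: image_eqI[of _ _ 1])
      then have "c (x ^ r) > 0" using c finD by (metis card_gt_0_iff empty_iff finite_Int)
      then have "card ((*) x ` P) \<le> card (D \<inter> (*) x ` P)"
        using dvd c x0 P(4) by (simp add: card_times_image dvd_imp_le)
      then have "D \<inter> (*) x ` P = (*) x ` P"
        using P(2) by (intro card_seteq) auto
      then show ?thesis using h by blast
    qed
    have sat': "x * h \<in> D'" if x: "x \<in> D'" "x \<notin> P" and h: "h \<in> P" for x h
    proof -
      have h0: "h \<noteq> 0" and hK: "h \<in> K" using h P'(1) P(3) by auto
      have xh: "x * h \<in> K" "x * h \<notin> P"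
      proof -
        show "x * h \<in> K" using x hK K'(5) by (auto simp: D'_def)
        show "x * h \<notin> P" using P'(3)[OF _ h, of "x * h"] x(2) h0 by auto
      qed
      have "x * h \<notin> D"
      proof
        assume "x * h \<in> D"
        then have "x * h * inverse h \<in> D" using sat xh(2) P'(4)[OF h] by blast
        then show False using x(1) h0 by (simp add: D'_def mult.assoc)
      qed
      then show ?thesis using xh P'(2) by (auto simp: D'_def)
    qed
    have stab: "(*) h0 ` A = A" if "finite A" "\<And>x. x \<in> A \<Longrightarrow> x * h0 \<in> A" for A
    proof (rule card_subset_eq)
      show "(*) h0 ` A \<subseteq> A" using that by (auto simp: mult.commute)
      show "card ((*) h0 ` A) = card A" using h0 P'(1) by (intro card_times_image) auto
    qed fact
    have finD': "finite D'" "0 \<notin> D'" using K(2) K'(1) by (auto simp: D'_def)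
    consider "D \<subseteq> P" | "D' \<subseteq> P" | "D \<inter> P = {}" | "D' \<inter> P = {}"
      | u u' h h' where "u \<in> D" "u \<notin> P" "u' \<in> D'" "u' \<notin> P" "h \<in> D" "h \<in> P" "h' \<in> D'" "h' \<in> P"
      by blast
    then show ?thesis
    proof cases
      case 1
      then show ?thesis using pds_subgroup_of_proper[OF K pds P(1) _ P(3)] by blast
    next
      case 2
      then show ?thesis using pds_subgroup_of_proper[OF K pds' P(1) _ P(3)] D'_eqs by simp
    next
      case 3
      then have "(*) h0 ` D = D" using sat h0 finD by (intro stab) auto
      moreover have "h0 \<in> K - D - {1}" using 3 h0 P(3) by blast
      ultimately show ?thesis using pds_subgroup_of_stabilizer[OF K pds] by blast
    next
      case 4
      then have "(*) h0 ` D' = D'" using sat' h0 finD' by (intro stab) auto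
      moreover have "h0 \<in> K - D' - {1}" using 4 h0 P(3) by blast
      ultimately show ?thesis using pds_subgroup_of_stabilizer[OF K pds'] D'_eqs by simp
    next
      \<comment> \<open>Both D and \<open>D'\<close> meet P and its complement. Applied to each of
        them, \<open>pds_saturated_quotient\<close> gives h' / h in D and h / h' in
        \<open>D'\<close>, against the closure of D under inverses.\<close>
      case 5
      obtain v v' where "\<And>g. g \<in> D \<Longrightarrow> card (D \<inter> (*) g ` D) = v"
        "\<And>g. g \<in> D' \<Longrightarrow> card (D' \<inter> (*) g ` D') = v'"
        using pds pds' unfolding partial_difference_set_def by metis
      then have "h' / h \<in> D" "h / h' \<in> D'"
        using pds_saturated_quotient[OF P(1,2) finD D0 _ sat, where u = u and h = h and h' = h']
          pds_saturated_quotient[OF P(1,2) finD' _ sat', where u = u' and h = h' and h' = h] 5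
        unfolding D'_def by blast+
      then show ?thesis using Dinv[of "h' / h"] by (simp add: D'_def)
    qed
  qed
qed

section \<open>Power subgroups of finite fields\<close>

lemma finite_field_generator:
  obtains g :: "'a::{field,finite}"
  where "bij_betw (\<lambda>i. g ^ i) {..<CARD('a) - 1} (UNIV - {0})" "g ^ (CARD('a) - 1) = 1"
proof -
  \<comment> \<open>The field type is repackaged as a ring record in order to apply the cyclicity of
    the multiplicative group there.\<close>
  define R :: "'a ring" where
    "R = \<lparr>carrier = UNIV, monoid.mult = (*), one = 1, ring.zero = 0, add = (+)\<rparr>"
  let ?G = "mult_of R"
  have "\<exists>y. x + y = 0" for x :: 'a by (rule exI[of _ "- x"]) simp
  moreover have "\<exists>y. x * y = 1" if "x \<noteq> 0" for x :: 'a
    using that by (intro exI[of _ "inverse x"]) simp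
  ultimately interpret R: Ring.field R
    by unfold_locales (auto simp: R_def algebra_simps Units_def)
  interpret G: group ?G by (rule R.field_mult_group)
  have carrier: "carrier ?G = UNIV - {0}"
    by (simp add: R_def)
  have carrier_R: "carrier R = UNIV" by (simp add: R_def)
  have pow: "x [^]\<^bsub>R\<^esub> (i::nat) = x ^ i" for x i
    by (induction i) (simp_all add: R_def nat_pow_def mult.commute)
  obtain g where "g \<in> carrier ?G" "carrier ?G = {g [^]\<^bsub>R\<^esub> i | i::nat. i \<in> UNIV}"
    using R.finite_field_mult_group_has_gen by (auto simp: R_def)
  then have g: "g \<noteq> 0" "UNIV - {0} = {g ^ i | i::nat. i \<in> UNIV}"
    unfolding carrier pow by auto
  let ?n = "CARD('a) - 1"
  have "order ?G = ?n" by (simp add: order_def carrier_R)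
  moreover have "g [^]\<^bsub>?G\<^esub> order ?G = \<one>\<^bsub>?G\<^esub>"
    using g carrier by (intro G.pow_order_eq_1) auto
  ultimately have one: "g ^ ?n = 1"
    by (simp add: nat_pow_mult_of pow) (simp add: R_def)
  have "card {0, 1::'a} \<le> CARD('a)" by (intro card_mono) auto
  then have n: "?n > 0" by simp
  have red: "g ^ i = g ^ (i mod ?n)" for i
  proof -
    have "g ^ i = g ^ (?n * (i div ?n) + i mod ?n)" by simp
    also have "\<dots> = g ^ (i mod ?n)" by (simp only: power_add power_mult one) simp
    finally show ?thesis .
  qed
  have surj: "(\<lambda>i. g ^ i) ` {..<?n} = UNIV - {0}"
  proof
    show "UNIV - {0} \<subseteq> (\<lambda>i. g ^ i) ` {..<?n}"
    proof
      fix x assume "x \<in> UNIV - {0::'a}"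
      then obtain i where "x = g ^ i" unfolding g(2) by blast
      then have "x = g ^ (i mod ?n)" "i mod ?n < ?n" using red n by auto
      then show "x \<in> (\<lambda>i. g ^ i) ` {..<?n}" by blast
    qed
  qed (use g in auto)
  then have "inj_on (\<lambda>i. g ^ i) {..<?n}"
    by (intro eq_card_imp_inj_on) simp_all
  with surj one show ?thesis using that unfolding bij_betw_def by blast
qed

lemma finite_field_generator_power_eq_iff:
  fixes g :: "'a::{field,finite}"
  assumes "bij_betw (\<lambda>i. g ^ i) {..<CARD('a) - 1} (UNIV - {0})" "g ^ (CARD('a) - 1) = 1"
  shows "g ^ i = g ^ j \<longleftrightarrow> [i = j] (mod (CARD('a) - 1))"
proof -
  let ?n = "CARD('a) - 1"
  have red: "g ^ i = g ^ (i mod ?n)" for i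
  proof -
    have "g ^ i = g ^ (?n * (i div ?n) + i mod ?n)" by simp
    also have "\<dots> = g ^ (i mod ?n)" by (simp only: power_add power_mult assms(2)) simp
    finally show ?thesis .
  qed
  have "card {0, 1::'a} \<le> CARD('a)" by (intro card_mono) auto
  then have "?n > 0" by simp
  then have "g ^ (i mod ?n) = g ^ (j mod ?n) \<longleftrightarrow> i mod ?n = j mod ?n"
    using assms(1) by (auto simp: bij_betw_def inj_on_def)
  then show ?thesis using red[of i] red[of j] by (simp add: cong_def)
qed

lemma finite_field_power_card_minus_1:
  fixes x :: "'a::{field,finite}"
  assumes "x \<noteq> 0"
  shows "x ^ (CARD('a) - 1) = 1"
proof -
  obtain g :: 'a where g: "bij_betw (\<lambda>i. g ^ i) {..<CARD('a) - 1} (UNIV - {0})" "g ^ (CARD('a) - 1) = 1"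
    by (rule finite_field_generator)
  have "x \<in> (\<lambda>i. g ^ i) ` {..<CARD('a) - 1}" using assms g(1) by (auto simp: bij_betw_def)
  then obtain i where x: "x = g ^ i" by blast
  show ?thesis
    unfolding x power_mult[symmetric] mult.commute[of i] by (simp only: power_mult g(2) power_one)
qed

lemma finite_field_power_card:
  fixes x :: "'a::{field,finite}"
  shows "x ^ CARD('a) = x"
proof (cases "x = 0")
  case False
  have "x ^ CARD('a) = x * x ^ (CARD('a) - 1)"
    by (metis Suc_diff_1 power_Suc zero_less_card_finite)
  then show ?thesis using finite_field_power_card_minus_1[OF False] by simp
qed simp

definition nonzero_powers :: "nat \<Rightarrow> 'a::field set" where
  "nonzero_powers e = {z ^ e | z. z \<noteq> 0}"

lemma mult_subgroup_nonzero_powers: "mult_subgroup (nonzero_powers e :: 'a::field set)"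
  unfolding mult_subgroup_def
proof (intro conjI ballI)
  show "0 \<notin> (nonzero_powers e :: 'a set)" "1 \<in> (nonzero_powers e :: 'a set)"
    by (auto simp: nonzero_powers_def intro!: exI[of _ 1])
  fix x y :: 'a assume "x \<in> nonzero_powers e" "y \<in> nonzero_powers e"
  then obtain x' y' where "x = x' ^ e" "y = y' ^ e" "x' \<noteq> 0" "y' \<noteq> 0"
    by (auto simp: nonzero_powers_def)
  then show "x / y \<in> nonzero_powers e"
    unfolding nonzero_powers_def by (intro CollectI exI[of _ "x' / y'"]) (simp add: power_divide)
qed

lemma uminus_mem_nonzero_powers_iff:
  "odd e \<Longrightarrow> - x \<in> nonzero_powers e \<longleftrightarrow> x \<in> nonzero_powers e" for x :: "'a::field"
proof -
  assume "odd e"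
  then have "- y \<in> nonzero_powers e" if y: "y \<in> nonzero_powers e" for y :: 'a
  proof -
    obtain z where "y = z ^ e" "z \<noteq> 0" using y by (auto simp: nonzero_powers_def)
    then show ?thesis
      using \<open>odd e\<close> unfolding nonzero_powers_def by (intro CollectI exI[of _ "- z"]) simp
  qed
  from this[of x] this[of "-x"] show ?thesis by auto
qed

lemma generator_power_mem_nonzero_powers_iff:
  fixes g :: "'a::{field,finite}"
  assumes g: "bij_betw (\<lambda>i. g ^ i) {..<CARD('a) - 1} (UNIV - {0})" "g ^ (CARD('a) - 1) = 1"
    and e: "e dvd CARD('a) - 1"
  shows "g ^ i \<in> nonzero_powers e \<longleftrightarrow> e dvd i"
proof
  have "card {0, 1::'a} \<le> CARD('a)" by (intro card_mono) auto
  then have "CARD('a) - 1 > 0" by simp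
  then have "g \<noteq> 0" using g(2) by (metis power_0_left zero_neq_one less_irrefl)
  assume "e dvd i"
  then obtain j where "i = e * j" by blast
  then show "g ^ i \<in> nonzero_powers e"
    using \<open>g \<noteq> 0\<close> by (auto simp: nonzero_powers_def power_mult[symmetric] mult.commute intro!: exI[of _ "g ^ j"])
next
  assume "g ^ i \<in> nonzero_powers e"
  then obtain z where z: "g ^ i = z ^ e" "z \<noteq> 0" by (auto simp: nonzero_powers_def)
  then have "z \<in> (\<lambda>i. g ^ i) ` {..<CARD('a) - 1}" using g(1) by (auto simp: bij_betw_def)
  then obtain j where "z = g ^ j" by blast
  then have "g ^ i = g ^ (j * e)" using z by (simp add: power_mult)
  then have "[i = j * e] (mod (CARD('a) - 1))"
    using finite_field_generator_power_eq_iff[OF g] by blast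
  then have "[i = j * e] (mod e)" using e cong_dvd_modulus_nat by blast
  then show "e dvd i" using cong_dvd_iff by fastforce
qed

text \<open>For a generator g of the multiplicative group, the d roots are the powers of g ^ (e *
  m). A prime d gives the subgroup P of Schur's argument, and m = 1 gives the order of K.\<close>

lemma card_nonzero_powers_roots:
  assumes e: "CARD('a::{field,finite}) - 1 = e * d * m" and "d > 0" "m > 0" "e > 0"
  shows "card {x \<in> (nonzero_powers e :: 'a set). x ^ d = 1} = d"
proof -
  obtain g :: 'a where g: "bij_betw (\<lambda>i. g ^ i) {..<CARD('a) - 1} (UNIV - {0})" "g ^ (CARD('a) - 1) = 1"
    by (rule finite_field_generator)
  have "{x \<in> (nonzero_powers e :: 'a set). x ^ d = 1} = (\<lambda>j. g ^ (e * m * j)) ` {..<d}"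
  proof (intro equalityI subsetI)
    fix x :: 'a assume x: "x \<in> {x \<in> nonzero_powers e. x ^ d = 1}"
    then have "x \<noteq> 0" using mult_subgroupD(1)[OF mult_subgroup_nonzero_powers] by blast
    then have "x \<in> (\<lambda>i. g ^ i) ` {..<CARD('a) - 1}" using g(1) by (auto simp: bij_betw_def)
    then obtain i where i: "x = g ^ i" "i < e * d * m" using e by auto
    have "g ^ (i * d) = g ^ 0" using x i by (simp add: power_mult)
    then have "e * d * m dvd i * d"
      using finite_field_generator_power_eq_iff[OF g] e by (metis cong_0_iff)
    then have "(e * m) * d dvd i * d" by (simp add: mult_ac)
    then have "e * m dvd i" using assms(2) by simp
    then obtain j where j: "i = e * m * j" by blast
    then have "j < d" using i(2) assms by (simp add: mult.assoc mult.left_commute mult.commute)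
    then show "x \<in> (\<lambda>j. g ^ (e * m * j)) ` {..<d}" using i j by blast
  next
    fix x assume "x \<in> (\<lambda>j. g ^ (e * m * j)) ` {..<d}"
    then obtain j where j: "x = g ^ (e * m * j)" by blast
    have "x \<in> nonzero_powers e"
      unfolding j using e by (subst generator_power_mem_nonzero_powers_iff[OF g]) simp_all
    moreover have "x ^ d = (g ^ (CARD('a) - 1)) ^ j"
      unfolding j e power_mult[symmetric] by (simp only: mult_ac)
    ultimately show "x \<in> {x \<in> nonzero_powers e. x ^ d = 1}" using g(2) by simp
  qed
  moreover have "inj_on (\<lambda>j. g ^ (e * m * j)) {..<d}"
  proof (rule inj_onI)
    fix i j assume ij: "i \<in> {..<d}" "j \<in> {..<d}" "g ^ (e * m * i) = g ^ (e * m * j)"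
    then have "[e * m * i = e * m * j] (mod (e * d * m))"
      using finite_field_generator_power_eq_iff[OF g] e by simp
    moreover have "e * m * i < e * d * m" "e * m * j < e * d * m" using ij assms by auto
    ultimately have "e * m * i = e * m * j" by (metis cong_less_modulus_unique_nat)
    then show "i = j" using assms by simp
  qed
  ultimately show ?thesis by (simp add: card_image)
qed

lemma card_nonzero_powers:
  assumes "CARD('a::{field,finite}) - 1 = e * k" "e > 0" "k > 0"
  shows "card (nonzero_powers e :: 'a set) = k"
proof -
  have "x ^ k = 1" if x: "x \<in> nonzero_powers e" for x :: 'a
  proof -
    obtain z where z: "x = z ^ e" "z \<noteq> 0" using x by (auto simp: nonzero_powers_def)
    have "x ^ k = z ^ (CARD('a) - 1)" unfolding assms(1) by (simp add: z power_mult)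
    then show ?thesis using finite_field_power_card_minus_1[OF z(2)] by simp
  qed
  then have "(nonzero_powers e :: 'a set) = {x \<in> nonzero_powers e. x ^ k = 1}" by auto
  also have "card \<dots> = k" using assms by (intro card_nonzero_powers_roots[where m = 1]) auto
  finally show ?thesis .
qed

text \<open>Relative to a generator, the coset of x is its exponent modulo e, and the Frobenius map
  multiplies that exponent by p. Since e is prime and p is a primitive root, every nonzero residue
  is reached from every other.\<close>

lemma nonzero_powers_frobenius_orbit:
  fixes x y :: "'a::{field,finite}"
  assumes "prime e" "residue_primroot e p" "e dvd CARD('a) - 1"
    and "x \<noteq> 0" "x \<notin> nonzero_powers e" "y \<noteq> 0" "y \<notin> nonzero_powers e"
  obtains t u where "u \<in> nonzero_powers e" "y = x ^ (p ^ t) * u"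
proof -
  obtain g :: 'a where g: "bij_betw (\<lambda>i. g ^ i) {..<CARD('a) - 1} (UNIV - {0})" "g ^ (CARD('a) - 1) = 1"
    by (rule finite_field_generator)
  note mem = generator_power_mem_nonzero_powers_iff[OF g assms(3)]
  have surj: "\<exists>i. z = g ^ i" if "z \<noteq> 0" for z
  proof -
    have "z \<in> (\<lambda>i. g ^ i) ` {..<CARD('a) - 1}" using that g(1) by (auto simp: bij_betw_def)
    then show ?thesis by blast
  qed
  from surj obtain i j where i: "x = g ^ i" and j: "y = g ^ j" using assms by metis
  have e1: "e > 1" using assms(1) prime_gt_1_nat by blast
  have cop: "coprime i e" "coprime j e"
    using assms mem i j by (auto simp: coprime_commute intro!: prime_imp_coprime)
  obtain i' where i': "[i * i' = 1] (mod e)" using cong_solve_coprime_nat[OF cop(1)] by auto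
  have "coprime (i' * j) e"
    using i' cop by (metis cong_imp_coprime cong_sym coprime_1_left coprime_mult_left_iff)
  \<comment> \<open>To carry the exponent i to j, the power p ^ t must represent j divided by i
    modulo e.\<close>
  then have "(i' * j) mod e \<in> totatives e"
    using e1 by (auto simp: totatives_def coprime_commute intro!: Nat.gr0I)
        (metis coprime_absorb_left coprime_commute coprime_mult_right_iff nat_dvd_1_iff_1 less_irrefl One_nat_def)
  then obtain t where t: "(i' * j) mod e = p ^ t mod e"
    using residue_primroot_is_generator[OF e1 assms(2)] by (auto simp: bij_betw_def)
  have "[i * p ^ t = i * (i' * j)] (mod e)"
    using t by (intro cong_mult cong_refl) (simp add: cong_def)
  also have "[i * (i' * j) = 1 * j] (mod e)"
    using i' by (subst mult.assoc[symmetric]) (intro cong_mult cong_refl)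
  finally have ij: "[i * p ^ t = j] (mod e)" by simp
  have xt: "x ^ (p ^ t) = g ^ (i * p ^ t)" by (simp add: i power_mult)
  obtain m where m: "y / x ^ (p ^ t) = g ^ m" using surj assms by (metis divide_eq_0_iff power_not_zero)
  have "g ^ (m + i * p ^ t) = g ^ j"
  proof -
    have "y = g ^ m * x ^ (p ^ t)" using m assms(4) by (metis nonzero_eq_divide_eq power_not_zero)
    then show ?thesis unfolding xt j power_add by simp
  qed
  then have "[m + i * p ^ t = j] (mod (CARD('a) - 1))"
    using finite_field_generator_power_eq_iff[OF g] by blast
  then have "[m + i * p ^ t = j] (mod e)" using assms(3) cong_dvd_modulus_nat by blast
  with ij have "[m + i * p ^ t = 0 + i * p ^ t] (mod e)" by (metis add_0 cong_sym cong_trans)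
  then have "[m = 0] (mod e)" by (simp only: cong_add_rcancel_nat)
  then have "g ^ m \<in> nonzero_powers e" using mem by (simp add: cong_0_iff)
  moreover have "y = x ^ (p ^ t) * g ^ m" using m assms by (simp add: field_simps)
  ultimately show ?thesis using that by blast
qed

section \<open>Gaussian periods\<close>

lemma CHAR_finite_field:
  assumes "prime p" "CARD('a::{field,finite}) = p ^ f"
  shows "CHAR('a) = p"
proof -
  have "CHAR('a) > 0" by (rule finite_imp_CHAR_pos) simp
  then have "prime CHAR('a)" by (rule prime_CHAR_semidom)
  moreover have "CHAR('a) dvd p ^ f" using CHAR_dvd_CARD[where 'a = 'a] assms by simp
  ultimately show ?thesis using assms(1) by (metis prime_dvd_power primes_dvd_imp_eq)
qed

text \<open>The polynomial x ^ p - x has at most p roots, and the images of the natural numbers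
  below p are already p of them.\<close>

lemma prime_field_eq_range_of_nat:
  fixes x :: "'a::{field,finite}"
  assumes "prime p" "CHAR('a) = p" "x ^ p = x"
  obtains n where "x = of_nat n"
proof -
  let ?P = "Polynomial.monom 1 p - Polynomial.monom 1 1 :: 'a poly"
  have p: "p > 1" using assms(1) prime_gt_1_nat by blast
  have coeff: "Polynomial.coeff ?P p \<noteq> 0" using p by simp
  then have P: "?P \<noteq> 0" by (metis coeff_0)
  have roots: "{x. poly ?P x = 0} = {x. x ^ p = x}" by (simp add: poly_monom)
  have "(of_nat n :: 'a) ^ p = of_nat n" for n
  proof (induction n)
    case (Suc n)
    have "(1 + of_nat n :: 'a) ^ p = 1 ^ p + of_nat n ^ p"
      by (rule freshmans_dream) (use assms in auto)
    then show ?case using Suc by simp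
  qed (use p in simp)
  then have "of_nat ` {..<p} \<subseteq> {x :: 'a. x ^ p = x}" by auto
  moreover have "card {x :: 'a. x ^ p = x} \<le> p"
    using card_poly_roots_bound[OF P] p unfolding roots
    by (meson degree_diff_le degree_monom_le le_trans less_imp_le)
  moreover have "inj_on (of_nat :: nat \<Rightarrow> 'a) {..<p}"
    using assms by (auto simp: inj_on_def of_nat_eq_iff_cong_CHAR cong_less_modulus_unique_nat)
  then have "card ((of_nat :: nat \<Rightarrow> 'a) ` {..<p}) = p" by (simp add: card_image)
  ultimately have "of_nat ` {..<p} = {x :: 'a. x ^ p = x}"
    by (intro card_seteq) simp_all
  then show ?thesis using assms that by blast
qed

text \<open>\<psi> x is exp(2 pi i Tr(x) / p) for the absolute trace Tr, which is invariant under
  Frobenius. It is nontrivial because the trace is a nonzero polynomial of degree at most p ^ (f -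
  1), less than the number of field elements.\<close>

lemma additive_character:
  assumes p: "prime p" and card: "CARD('a::{field,finite}) = p ^ f" and f: "f > 0"
  obtains \<psi> :: "'a::{field,finite} \<Rightarrow> complex" where
    "\<And>x y. \<psi> (x + y) = \<psi> x * \<psi> y" "\<And>x. \<psi> (x ^ p) = \<psi> x" "\<psi> 0 = 1" "\<exists>x. \<psi> x \<noteq> 1"
proof -
  have char: "CHAR('a) = p" using CHAR_finite_field[OF p card] .
  have p1: "p > 1" using p prime_gt_1_nat by blast
  define tr where "tr x = (\<Sum>i<f. x ^ (p ^ i))" for x :: 'a
  have tr_add: "tr (x + y) = tr x + tr y" for x y
    using freshmans_dream'[where 'a = 'a] p char by (simp add: tr_def sum.distrib)
  have tr_0: "tr 0 = 0" using p1 by (simp add: tr_def power_0_left)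
  have tr_pow: "tr (x ^ p) = tr x" for x
  proof -
    have "tr (x ^ p) = (\<Sum>i<f. x ^ (p ^ Suc i))"
      unfolding tr_def by (simp flip: power_mult)
    moreover have "(\<Sum>i<Suc f. x ^ (p ^ i)) = x + (\<Sum>i<f. x ^ (p ^ Suc i))"
      by (subst sum.lessThan_Suc_shift) simp
    moreover have "(\<Sum>i<Suc f. x ^ (p ^ i)) = tr x + x"
      using finite_field_power_card[of x] card by (simp add: tr_def)
    ultimately show ?thesis by simp
  qed
  have "tr x ^ p = tr (x ^ p)" for x
  proof -
    have "tr x ^ p = (\<Sum>i<f. (x ^ (p ^ i)) ^ p)"
      unfolding tr_def by (rule freshmans_dream_sum) (use p char in auto)
    also have "\<dots> = tr (x ^ p)"
      unfolding tr_def by (simp add: mult.commute flip: power_mult)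
    finally show ?thesis .
  qed
  then have "tr x ^ p = tr x" for x using tr_pow by simp
  then have "\<exists>n. tr x = of_nat n" for x
    using prime_field_eq_range_of_nat[OF p char] by metis
  \<comment> \<open>\<open>N\<close> picks some natural number representing the trace. The choice is
    harmless, because \<open>E\<close> depends only on the residue modulo p.\<close>
  then obtain N where N: "\<And>x. tr x = of_nat (N x)" by metis
  define E :: "nat \<Rightarrow> complex" where "E m = exp (2 * of_real pi * \<i> * of_nat m / of_nat p)" for m
  have E_eq: "E m = E n \<longleftrightarrow> (of_nat m :: 'a) = of_nat n" for m n
    using complex_root_unity_eq[of p m n] p1 char
    by (simp add: E_def of_nat_eq_iff_cong_CHAR cong_def)
  have E_add: "E (m + n) = E m * E n" for m n
    by (simp add: E_def ring_distribs add_divide_distrib exp_add)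
  have E_0: "E 0 = 1" by (simp add: E_def)
  show ?thesis
  proof (rule that[of "\<lambda>x. E (N x)"])
    show "E (N (x + y)) = E (N x) * E (N y)" for x y
      unfolding E_add[symmetric] E_eq using N tr_add by (metis of_nat_add)
    show "E (N (x ^ p)) = E (N x)" for x
      unfolding E_eq using N tr_pow by metis
    show "E (N 0) = 1"
      unfolding E_0[symmetric] E_eq using N tr_0 by (metis of_nat_0)
    show "\<exists>x. E (N x) \<noteq> 1"
    proof (rule ccontr)
      assume "\<not> ?thesis"
      then have tr0: "tr x = 0" for x unfolding N E_0[symmetric] E_eq by simp
      let ?P = "\<Sum>i<f. Polynomial.monom 1 (p ^ i) :: 'a poly"
      have "Polynomial.coeff ?P 1 = (\<Sum>i<f. if i = 0 then 1 else 0)"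
        using p1 unfolding coeff_sum by (intro sum.cong) auto
      then have coeff: "Polynomial.coeff ?P 1 = 1" using f by simp
      have P: "?P \<noteq> 0"
      proof
        assume "?P = 0"
        then show False using coeff by (simp only: coeff_0) simp
      qed
      have "poly ?P x = 0" for x using tr0[of x] by (simp add: poly_sum poly_monom tr_def)
      then have "CARD('a) \<le> Polynomial.degree ?P" using card_poly_roots_bound[OF P] by simp
      also have "Polynomial.degree ?P \<le> p ^ (f - 1)"
        using p1 by (intro degree_sum_le) (auto intro!: order.trans[OF degree_monom_le] power_increasing)
      also have "\<dots> < p ^ f" using p1 f by simp
      finally show False using card by simp
    qed
  qed
qed

section \<open>Orthogonality and moments of character sums\<close>

lemma sum_additive_character:
  fixes \<psi> :: "'a::{field,finite} \<Rightarrow> complex"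
  assumes add: "\<And>x y. \<psi> (x + y) = \<psi> x * \<psi> y" and "\<psi> 0 = 1" "\<exists>x. \<psi> x \<noteq> 1"
  shows "(\<Sum>a\<in>UNIV. \<psi> (a * c)) = of_nat CARD('a) * of_bool (c = 0)"
proof (cases "c = 0")
  case False
  obtain b where b: "\<psi> b \<noteq> 1" using assms by blast
  have bij: "bij_betw (\<lambda>a. a * c) UNIV UNIV"
    using False by (intro bij_betwI[where g = "\<lambda>a. a / c"]) auto
  have "(\<Sum>a\<in>UNIV. \<psi> (a * c)) = (\<Sum>a\<in>UNIV. \<psi> a)"
    by (rule sum.reindex_bij_betw[OF bij])
  moreover have "(\<Sum>a\<in>UNIV. \<psi> a) = (\<Sum>a\<in>UNIV. \<psi> (b + a))"
    by (rule sum.reindex_bij_betw[symmetric]) (rule bij_betwI[where g = "\<lambda>a. a - b"], auto)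
  then have "(\<Sum>a\<in>UNIV. \<psi> a) = \<psi> b * (\<Sum>a\<in>UNIV. \<psi> a)"
    unfolding add sum_distrib_left[symmetric] .
  then have "(\<psi> b - 1) * (\<Sum>a\<in>UNIV. \<psi> a) = 0" by (simp add: algebra_simps)
  ultimately show ?thesis using b False by simp
qed (use assms in simp)

text \<open>A power of \<open>s a\<close> expands into values of \<psi> at a times sums of elements
  of K; summing over a, orthogonality keeps just the tuples with sum 0.\<close>

lemma sum_character_moments:
  fixes \<psi> :: "'a::{field,finite} \<Rightarrow> complex" and K :: "'a set"
  assumes \<psi>: "\<And>x y. \<psi> (x + y) = \<psi> x * \<psi> y" "\<psi> 0 = 1" "\<exists>x. \<psi> x \<noteq> 1"
  defines "s \<equiv> \<lambda>a. \<Sum>x\<in>K. \<psi> (a * x)"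
  shows "(\<Sum>a\<in>UNIV. s a) = of_nat (CARD('a) * card {x \<in> K. x = 0})"
    and "(\<Sum>a\<in>UNIV. s a ^ 2) = of_nat (CARD('a) * card {(x, y) \<in> K \<times> K. x + y = 0})"
    and "(\<Sum>a\<in>UNIV. s a ^ 3) = of_nat (CARD('a) * card {(x, y, z) \<in> K \<times> K \<times> K. x + y + z = 0})"
proof -
  have main: "(\<Sum>a\<in>UNIV. \<Sum>t\<in>A. \<psi> (a * h t)) = of_nat (CARD('a) * card {t \<in> A. h t = 0})"
    if "finite A" for A and h :: "'i \<Rightarrow> 'a"
  proof -
    have "(\<Sum>a\<in>UNIV. \<Sum>t\<in>A. \<psi> (a * h t)) = (\<Sum>t\<in>A. of_nat CARD('a) * of_bool (h t = 0))"
      by (subst sum.swap) (simp add: sum_additive_character[OF \<psi>])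
    also have "\<dots> = of_nat (CARD('a) * card {t \<in> A. h t = 0})"
      using that by (simp add: sum_distrib_left[symmetric] of_bool_def sum.If_cases Int_def)
    finally show ?thesis .
  qed
  show "(\<Sum>a\<in>UNIV. s a) = of_nat (CARD('a) * card {x \<in> K. x = 0})"
    unfolding s_def by (rule main) simp
  have sq: "s a ^ 2 = (\<Sum>t\<in>K \<times> K. \<psi> (a * (fst t + snd t)))" for a
    by (simp add: s_def power2_eq_square sum_product sum.cartesian_product \<psi>(1) ring_distribs
        case_prod_unfold)
  show "(\<Sum>a\<in>UNIV. s a ^ 2) = of_nat (CARD('a) * card {(x, y) \<in> K \<times> K. x + y = 0})"
    unfolding sq by (subst main) (simp_all add: case_prod_unfold mem_Times_iff conj_assoc)
  have cube: "s a ^ 3 = (\<Sum>t\<in>K \<times> K \<times> K. \<psi> (a * (fst t + fst (snd t) + snd (snd t))))" for a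
  proof -
    have "s a ^ 3 = s a * s a ^ 2" by (simp add: power3_eq_cube power2_eq_square)
    also have "\<dots> = (\<Sum>x\<in>K. \<Sum>t\<in>K \<times> K. \<psi> (a * x) * \<psi> (a * (fst t + snd t)))"
      unfolding sq by (simp add: s_def sum_product)
    also have "\<dots> = (\<Sum>x\<in>K. \<Sum>t\<in>K \<times> K. \<psi> (a * (x + fst t + snd t)))"
      by (simp add: \<psi>(1)[symmetric] ring_distribs add.assoc)
    also have "\<dots> = (\<Sum>t\<in>K \<times> K \<times> K. \<psi> (a * (fst t + fst (snd t) + snd (snd t))))"
      by (simp add: sum.cartesian_product case_prod_unfold)
    finally show ?thesis .
  qed
  show "(\<Sum>a\<in>UNIV. s a ^ 3) = of_nat (CARD('a) * card {(x, y, z) \<in> K \<times> K \<times> K. x + y + z = 0})"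
    unfolding cube by (subst main) (simp_all add: case_prod_unfold mem_Times_iff conj_assoc)
qed


text \<open>A solution of x + y + z = 0 is determined by x and d = - y / x. Then z = x * (d - 1), so
  d and d - 1 both lie in K.\<close>

lemma cayley_difference_card:
  assumes K: "mult_subgroup K" and minus: "\<And>x. x \<in> K \<Longrightarrow> - x \<in> K"
  shows "card {(x, y) \<in> K \<times> K. x + y = 0} = card K"
    and "card {(x, y, z) \<in> K \<times> K \<times> K. x + y + z = 0} = card K * card {x \<in> K. x - 1 \<in> K}"
proof -
  note K' = mult_subgroupD[OF K]
  have "{(x, y) \<in> K \<times> K. x + y = 0} = (\<lambda>x. (x, - x)) ` K"
    using minus by (auto simp: add_eq_0_iff)
  then show "card {(x, y) \<in> K \<times> K. x + y = 0} = card K"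
    by (simp add: card_image inj_on_def)
  have "bij_betw (\<lambda>(x, d). (x, - (x * d), x * (d - 1))) (K \<times> {x \<in> K. x - 1 \<in> K})
      {(x, y, z) \<in> K \<times> K \<times> K. x + y + z = 0}"
  proof (rule bij_betwI[where g = "\<lambda>(x, y, z). (x, - y / x)"], goal_cases)
    case 1
    show ?case using K'(5) minus by (auto simp: algebra_simps) (metis K'(5) mult.commute mult_1_right right_diff_distrib)
  next
    case 2
    have "- y / x - 1 = z / x" "- y / x \<in> K" "z / x \<in> K"
      if "x \<in> K" "y \<in> K" "z \<in> K" "x + y + z = 0" for x y z
    proof -
      have "x \<noteq> 0" using that K'(1) by auto
      moreover have z: "z = - x - y" using that(4) by (simp add: eq_neg_iff_add_eq_0 algebra_simps)
      ultimately show "- y / x - 1 = z / x" unfolding z by (simp add: field_simps)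
      show "- y / x \<in> K" "z / x \<in> K" using K'(3) minus that by blast+
    qed
    then show ?case by (auto simp del: divide_minus_left minus_divide_left)
  next
    case (3 t)
    then show ?case using K'(1) by auto
  next
    case (4 t)
    then obtain x y z where t: "t = (x, y, z)" "x \<in> K" "x + y + z = 0" by auto
    have "x \<noteq> 0" using t K'(1) by auto
    moreover have z: "z = - x - y" using t(3) by (simp add: eq_neg_iff_add_eq_0 algebra_simps)
    ultimately show ?case unfolding t(1) z by (simp add: field_simps)
  qed
  from bij_betw_same_card[OF this]
  show "card {(x, y, z) \<in> K \<times> K \<times> K. x + y + z = 0} = card K * card {x \<in> K. x - 1 \<in> K}"
    by (simp add: card_cartesian_product)
qed

text \<open>Here a is the Gaussian period on K, b the one shared by the other cosets, and the three
  equations are the first three moments. They determine in turn a, k and l from b. The type is a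
  general field because the periods are complex until b is shown to be an integer.\<close>

lemma uniform_period_identities:
  fixes e k q l a b :: "'a::field_char_0"
  assumes k: "k \<noteq> 0" and q: "q = e * k + 1" "q \<noteq> 0" "e \<noteq> 0" "e \<noteq> 1"
    and 1: "k + k * a + (e - 1) * k * b = 0"
    and 2: "k ^ 2 + k * a ^ 2 + (e - 1) * k * b ^ 2 = q * k"
    and 3: "k ^ 3 + k * a ^ 3 + (e - 1) * k * b ^ 3 = q * (k * l)"
  shows "(e * b + 1) ^ 2 = q" and "k = b * (e * b + 2)" and "l = b ^ 2 - (e - 3) * b - 1"
proof -
  have "k * (1 + a + (e - 1) * b) = 0" using 1 by (simp add: algebra_simps)
  then have "a + (1 + (e - 1) * b) = 0" using k by (simp add: add_ac)
  then have a: "a = - (1 + (e - 1) * b)" by (simp only: eq_neg_iff_add_eq_0)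
  have "k * (k + a ^ 2 + (e - 1) * b ^ 2) = k * q" using 2 by (simp add: algebra_simps power2_eq_square)
  then have 2: "k + a ^ 2 + (e - 1) * b ^ 2 = q" using k by simp
  have "k * (k ^ 2 + a ^ 3 + (e - 1) * b ^ 3) = k * (q * l)"
    using 3 by (simp add: algebra_simps power2_eq_square power3_eq_cube)
  then have 3: "k ^ 2 + a ^ 3 + (e - 1) * b ^ 3 = q * l" using k by simp
  have "(e - 1) * (k - b * (e * b + 2)) = q - (k + a ^ 2 + (e - 1) * b ^ 2)"
    unfolding a q(1) by (simp add: algebra_simps power2_eq_square)
  then have "(e - 1) * (k - b * (e * b + 2)) = 0" using 2 by simp
  then show kb: "k = b * (e * b + 2)" using q(4) by simp
  then show qb: "(e * b + 1) ^ 2 = q" unfolding q(1) by (simp add: algebra_simps power2_eq_square)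
  have "q * l = k ^ 2 + a ^ 3 + (e - 1) * b ^ 3" using 3 by simp
  also have "\<dots> = (e * b + 1) ^ 2 * (b ^ 2 - (e - 3) * b - 1)"
    unfolding a kb by (simp add: algebra_simps power2_eq_square power3_eq_cube)
  finally have "q * l = q * (b ^ 2 - (e - 3) * b - 1)" unfolding qb .
  then show "l = b ^ 2 - (e - 3) * b - 1" using q by simp
qed

text \<open>The map \<open>x \<mapsto> x ^ p\<close> permutes the cosets of the \<open>e\<close>-th powers other than the trivial one
  transitively and fixes the character, so the Gaussian periods take only two values.\<close>

theorem uniform_cyclotomy:
  fixes p e l :: nat
  defines "K \<equiv> nonzero_powers e :: 'a::{field,finite} set"
  assumes p: "prime p" and e: "prime e" "odd e" and primroot: "residue_primroot e p"
    and l: "l \<ge> 1" and card: "CARD('a) = p ^ ((e - 1) * l)"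
  obtains \<eta> :: int where "\<bar>int e * \<eta> + 1\<bar> = int p ^ ((e - 1) div 2 * l)"
    "int (card K) = \<eta> * (int e * \<eta> + 2)"
    "int (card {x \<in> K. x - 1 \<in> K}) = \<eta>\<^sup>2 - (int e - 3) * \<eta> - 1"
    "CARD('a) - 1 = e * card K" "card K > 0"
proof -
  let ?f = "(e - 1) * l"
  have e3: "e \<ge> 3" using e prime_ge_2_nat[OF e(1)] by (cases "e = 2") auto
  have p1: "p > 1" using p prime_gt_1_nat by blast
  have f: "?f > 0" using e3 l by simp
  have q1: "CARD('a) > 1" unfolding card using p1 f by (rule one_less_power)
  have "coprime e p" using primroot by (simp add: residue_primroot_def)
  then have "[p ^ (e - 1) = 1] (mod e)"
    using fermat_theorem[OF e(1), of p] e(1) by (metis coprime_absorb_left not_prime_1 nat_dvd_1_iff_1)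
  then have "[(p ^ (e - 1)) ^ l = 1 ^ l] (mod e)" by (rule cong_pow)
  then have "[CARD('a) = 1] (mod e)" by (simp add: card power_mult)
  then have edvd: "e dvd CARD('a) - 1" using q1 by (simp add: cong_altdef_nat cong_sym)
  then obtain k where k: "CARD('a) - 1 = e * k" by blast
  have k0: "k > 0" using k q1 by (cases k) auto
  have cardK: "card K = k" unfolding K_def using card_nonzero_powers[OF k _ k0] e3 by simp
  have K: "mult_subgroup K" unfolding K_def by (rule mult_subgroup_nonzero_powers)
  note K' = mult_subgroupD[OF K]
  have minus: "- x \<in> K" if "x \<in> K" for x
    using that by (simp add: K_def uminus_mem_nonzero_powers_iff[OF e(2)])
  obtain \<psi> :: "'a \<Rightarrow> complex" where \<psi>: "\<And>x y. \<psi> (x + y) = \<psi> x * \<psi> y" "\<psi> 0 = 1" "\<exists>x. \<psi> x \<noteq> 1"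
    and frob: "\<And>x. \<psi> (x ^ p) = \<psi> x"
    using additive_character[OF p card f] by metis
  define s where "s a = (\<Sum>x\<in>K. \<psi> (a * x))" for a
  have s_mult: "s (a * u) = s a" if u: "u \<in> K" for a u
  proof -
    have "u \<noteq> 0" using u K' by auto
    then have "(\<Sum>x\<in>(*) u ` K. \<psi> (a * x)) = (\<Sum>x\<in>K. \<psi> (a * (u * x)))"
      by (subst sum.reindex) (auto simp: inj_on_def)
    then show ?thesis using mult_subgroup_coset[OF K u] by (simp add: s_def mult.assoc)
  qed
  have s_frob: "s (a ^ p) = s a" for a
  proof -
    have inj: "inj (\<lambda>x::'a. x ^ p)"
    proof (rule injI)
      fix x y :: 'a assume eq: "x ^ p = y ^ p"
      have "z ^ CARD('a) = (z ^ p) ^ (p ^ (?f - 1))" for z :: 'a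
        unfolding card using f by (metis power_mult power_Suc Suc_diff_1)
      then show "x = y" using eq finite_field_power_card by metis
    qed
    have "(\<lambda>x. x ^ p) ` K = K"
      using inj K'(6) by (intro endo_inj_surj) (auto intro: inj_on_subset)
    then have "s (a ^ p) = (\<Sum>x\<in>(\<lambda>x. x ^ p) ` K. \<psi> (a ^ p * x))" by (simp add: s_def)
    also have "\<dots> = (\<Sum>x\<in>K. \<psi> ((a * x) ^ p))"
      using inj by (subst sum.reindex) (auto intro: inj_on_subset simp: power_mult_distrib)
    finally show ?thesis by (simp add: s_def frob)
  qed
  have s_frob': "s (a ^ (p ^ t)) = s a" for a t
  proof (induction t)
    case (Suc t)
    have "a ^ (p ^ Suc t) = (a ^ (p ^ t)) ^ p" by (simp add: mult.commute flip: power_mult)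
    then show ?case using Suc s_frob by simp
  qed simp
  have s_0: "s 0 = of_nat k" by (simp add: s_def \<psi>(2) cardK)
  have s_K: "s a = s 1" if "a \<in> K" for a using s_mult[OF that, of 1] by simp
  define N where "N = UNIV - {0} - K"
  obtain b where s_N: "s a = b" if "a \<in> N" for a
  proof (cases "N = {}")
    case False
    then obtain c where c: "c \<in> N" by blast
    have "s a = s c" if "a \<in> N" for a
    proof -
      from that c have "c \<noteq> 0" "c \<notin> nonzero_powers e" "a \<noteq> 0" "a \<notin> nonzero_powers e"
        by (auto simp: N_def K_def)
      then obtain t u where "u \<in> nonzero_powers e" "a = c ^ (p ^ t) * u"
        using nonzero_powers_frobenius_orbit[OF e(1) primroot edvd] by blast
      then show ?thesis using s_mult s_frob' by (simp add: K_def)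
    qed
    then show ?thesis using that by blast
  qed (use that in blast)
  have UNIV_eq: "UNIV = insert 0 (K \<union> N)" by (auto simp: N_def)
  have "card N = CARD('a) - 1 - k"
    unfolding N_def using K'(1) cardK by (subst card_Diff_subset) auto
  then have "card N = (e - 1) * k" unfolding k by (simp add: diff_mult_distrib)
  then have cardN: "of_nat (card N) = (of_nat e - 1) * (of_nat k :: complex)"
    using e3 by (simp add: of_nat_diff)
  have sum_s: "(\<Sum>a\<in>UNIV. s a ^ j) = of_nat k ^ j + of_nat k * s 1 ^ j + (of_nat e - 1) * of_nat k * b ^ j" for j
  proof -
    have "(\<Sum>a\<in>UNIV. s a ^ j) = s 0 ^ j + ((\<Sum>a\<in>K. s a ^ j) + (\<Sum>a\<in>N. s a ^ j))"
    proof -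
      have "0 \<notin> K \<union> N" "K \<inter> N = {}" using K'(1) by (auto simp: N_def)
      then show ?thesis unfolding UNIV_eq by (simp add: sum.union_disjoint)
    qed
    then show ?thesis using cardK cardN s_K s_N s_0 by simp
  qed
  note moments = sum_character_moments[OF \<psi>, of K, folded s_def]
  let ?D = "{x \<in> K. x - 1 \<in> K}"
  let ?e = "of_nat e :: complex" and ?k = "of_nat k :: complex" and ?q = "of_nat CARD('a) :: complex"
  let ?l = "of_nat (card ?D) :: complex"
  have "{x \<in> K. x = 0} = {}" using K'(1) by auto
  then have "(\<Sum>a\<in>UNIV. s a) = 0" using moments(1) by (simp only: card.empty) simp
  then have 1: "?k + ?k * s 1 + (?e - 1) * ?k * b = 0"
    using sum_s[of 1] by simp
  have 2: "?k ^ 2 + ?k * s 1 ^ 2 + (?e - 1) * ?k * b ^ 2 = ?q * ?k"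
    using moments(2) sum_s[of 2] cayley_difference_card(1)[OF K minus] cardK by simp
  have 3: "?k ^ 3 + ?k * s 1 ^ 3 + (?e - 1) * ?k * b ^ 3 = ?q * (?k * ?l)"
    using moments(3) sum_s[of 3] cayley_difference_card(2)[OF K minus] cardK by simp
  have qk: "CARD('a) = e * k + 1" using k q1 by simp
  then have q: "?q = ?e * ?k + 1" by (simp only: of_nat_add of_nat_mult of_nat_1)
  note ids = uniform_period_identities[OF _ q _ _ _ 1 2 3]
  have ne: "?k \<noteq> 0" "?q \<noteq> 0" "?e \<noteq> 0" "?e \<noteq> 1" using k0 e3 by auto
  \<comment> \<open>As e is odd, q is the square of \<open>Q\<close>, so e * b + 1 is
    \<open>Q\<close> or \<open>- Q\<close>; \<open>S\<close> carries this sign.\<close>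
  define Q where "Q = int p ^ ((e - 1) div 2 * l)"
  have "?q = of_int Q ^ 2"
  proof -
    have "(e - 1) * l = ((e - 1) div 2 * l) * 2" using e(2) by (auto elim: oddE)
    then show ?thesis 
      unfolding card Q_def by (simp only: of_nat_power of_int_power of_int_of_nat_eq power_mult)
  qed
  then have "(?e * b + 1) ^ 2 = of_int Q ^ 2" using ids(1)[OF ne] by simp
  then have "?e * b + 1 = of_int Q \<or> ?e * b + 1 = - of_int Q" by (simp only: power2_eq_iff)
  then obtain S where S: "?e * b + 1 = of_int S" "\<bar>S\<bar> = Q"
  proof
    assume "?e * b + 1 = of_int Q"
    then show ?thesis using that[of Q] by (simp add: Q_def)
  next
    assume "?e * b + 1 = - of_int Q"
    then show ?thesis using that[of "- Q"] by (simp add: Q_def)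
  qed
  have b: "?e * b = of_int (S - 1)" using S by (simp add: algebra_simps)
  \<comment> \<open>So far only e * b is known to be an integer. Clearing denominators in the
    formula for |D| shows that e divides (S - 1) ^ 2; as e is prime, it divides S - 1, and b is an
    integer.\<close>
  have "?e ^ 2 * ?l = (?e * b) ^ 2 - (?e - 3) * ?e * (?e * b) - ?e ^ 2"
    unfolding ids(3)[OF ne] by (simp add: algebra_simps power2_eq_square)
  also have "\<dots> = of_int ((S - 1) ^ 2 - (int e - 3) * int e * (S - 1) - int e ^ 2)"
    unfolding b by simp
  finally have "of_int (int e ^ 2 * int (card ?D)) =
      (of_int ((S - 1) ^ 2 - (int e - 3) * int e * (S - 1) - int e ^ 2) :: complex)" by simp
  then have eq: "int e ^ 2 * int (card ?D) = (S - 1) ^ 2 - (int e - 3) * int e * (S - 1) - int e ^ 2"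
    by (simp only: of_int_eq_iff)
  have "(S - 1) ^ 2 = int e * (int e * int (card ?D) + (int e - 3) * (S - 1) + int e)"
    using eq by (simp add: algebra_simps power2_eq_square)
  then have "int e dvd (S - 1) ^ 2" by simp
  then have "int e dvd S - 1" using e(1) by (simp add: prime_dvd_power)
  then obtain \<eta> where \<eta>: "S - 1 = int e * \<eta>" by blast
  then have b_eta: "b = of_int \<eta>" using b ne(3) by simp
  show ?thesis
  proof (rule that[of \<eta>])
    show "\<bar>int e * \<eta> + 1\<bar> = int p ^ ((e - 1) div 2 * l)" using S(2) \<eta> by (simp add: Q_def)
    have "of_int (int k) = (of_int (\<eta> * (int e * \<eta> + 2)) :: complex)"
      using ids(2)[OF ne] by (simp add: b_eta)
    then show "int (card K) = \<eta> * (int e * \<eta> + 2)" unfolding cardK by (simp only: of_int_eq_iff)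
    have "of_int (int (card ?D)) = (of_int (\<eta>\<^sup>2 - (int e - 3) * \<eta> - 1) :: complex)"
      using ids(3)[OF ne] by (simp add: b_eta)
    then show "int (card ?D) = \<eta>\<^sup>2 - (int e - 3) * \<eta> - 1" by (simp only: of_int_eq_iff)
    show "CARD('a) - 1 = e * card K" "card K > 0" using k cardK k0 by simp_all
  qed
qed

section \<open>Triple intersection numbers\<close>

lemma subspace_Inter: "(\<And>S. S \<in> \<S> \<Longrightarrow> cmat.subspace S) \<Longrightarrow> cmat.subspace (\<Inter>\<S>)"
  unfolding cmat.subspace_def by blast

lemma subalgebra_hull: "subalgebra (subalgebra hull S)"
  unfolding hull_def subalgebra_def by (blast intro: subspace_Inter)

definition same_relation :: "('v \<Rightarrow> 'v \<Rightarrow> bool) \<Rightarrow> 'v \<Rightarrow> 'v \<Rightarrow> 'v \<Rightarrow> 'v \<Rightarrow> bool" where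
  "same_relation E x y x' y' \<longleftrightarrow> (x = y \<longleftrightarrow> x' = y') \<and> (E x y \<longleftrightarrow> E x' y')"

lemma A_mat_same_relation:
  "same_relation E x y x' y' \<Longrightarrow> A_mat E i $ x $ y = A_mat E i $ x' $ y'"
  by (simp add: A_mat_def same_relation_def adj_matrix_def all_ones_def mat_def)

lemma Estar_mult_left: "(Estar E \<omega> i ** M) $ x $ y = A_mat E i $ \<omega> $ x * M $ x $ y"
  by (simp add: matrix_matrix_mult_def Estar_def if_distrib[of "\<lambda>a. a * _"] cong: if_cong)

lemma Estar_mult_right: "(M ** Estar E \<omega> i) $ x $ y = M $ x $ y * A_mat E i $ \<omega> $ y"
  by (simp add: matrix_matrix_mult_def Estar_def if_distrib[of "\<lambda>a. _ * a"] cong: if_cong)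

text \<open>The (x, y) entry of a spanning product is the product of entries of \<open>A_mat\<close>
  at (\<omega>, x), (x, y) and (\<omega>, y).\<close>

lemma terwilliger_span_same_relation:
  assumes M: "M \<in> terwilliger_span E \<omega>"
    and rel: "same_relation E \<omega> x \<omega> x'" "same_relation E \<omega> y \<omega> y'" "same_relation E x y x' y'"
  shows "M $ x $ y = M $ x' $ y'"
  using M unfolding terwilliger_span_def
proof (induction rule: cmat.span_induct_alt)
  case base
  then show ?case by simp
next
  case (step c B N)
  then obtain i j k where "B = Estar E \<omega> i ** A_mat E j ** Estar E \<omega> k" by blast
  then have "B $ x $ y = B $ x' $ y'"
    using A_mat_same_relation[OF rel(1)] A_mat_same_relation[OF rel(2)] A_mat_same_relation[OF rel(3)]
    by (simp add: Estar_mult_left Estar_mult_right)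
  then show ?case using step by (simp add: cscale_def)
qed

text \<open>The product of \<open>A_mat E 1\<close>, \<open>Estar E \<omega> 1\<close> and
  \<open>A_mat E 1\<close> lies in the algebra, and its (x, y) entry is this count. Membership in
  the span makes the entry depend on relations only.\<close>

lemma card_common_neighbours:
  assumes span: "terwilliger_span E \<omega> = terwilliger_algebra E \<omega>"
    and rel: "same_relation E \<omega> x \<omega> x'" "same_relation E \<omega> y \<omega> y'" "same_relation E x y x' y'"
  shows "card {z. E \<omega> z \<and> E x z \<and> E z y} = card {z. E \<omega> z \<and> E x' z \<and> E z y'}"
proof -
  have alg: "subalgebra (terwilliger_algebra E \<omega>)"
    unfolding terwilliger_algebra_def by (rule subalgebra_hull)
  let ?M = "A_mat E 1 ** Estar E \<omega> 1 ** A_mat E 1"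
  have "{A_mat E 1, Estar E \<omega> 1} \<subseteq> terwilliger_algebra E \<omega>"
    unfolding terwilliger_algebra_def by (rule order.trans[OF _ hull_subset]) auto
  then have "?M \<in> terwilliger_span E \<omega>"
    using alg unfolding span subalgebra_def by simp
  from terwilliger_span_same_relation[OF this rel]
  have "?M $ x $ y = ?M $ x' $ y'" .
  moreover have "?M $ u $ v = of_nat (card {z. E \<omega> z \<and> E u z \<and> E z v})" for u v
  proof -
    have "?M $ u $ v = (\<Sum>z\<in>UNIV. (A_mat E 1 ** Estar E \<omega> 1) $ u $ z * A_mat E 1 $ z $ v)"
      by (simp add: matrix_matrix_mult_def)
    also have "\<dots> = (\<Sum>z\<in>UNIV. if E \<omega> z \<and> E u z \<and> E z v then 1 else 0)"
      unfolding Estar_mult_right by (intro sum.cong) (auto simp: A_mat_def adj_matrix_def)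
    finally show ?thesis by (simp add: sum.If_cases)
  qed
  ultimately show ?thesis by simp
qed

section \<open>Arithmetic of the parameters\<close>

text \<open>The base case is 882 < 1024. In \<open>small_parameters_of_dvd\<close> this leaves only
  m < 10.\<close>

lemma two_power_gt_square: "m \<ge> 10 \<Longrightarrow> 2 * (2 * m + 1)\<^sup>2 < 2 ^ m" for m :: nat
proof (induction m rule: dec_induct)
  case (step m)
  have "10 * m \<le> m * m" using step by simp
  moreover have "(2 * Suc m + 1)\<^sup>2 = 4 * (m * m) + 12 * m + 9"
    "2 * (2 * m + 1)\<^sup>2 = 8 * (m * m) + 8 * m + 2"
    by (simp_all add: power2_eq_square algebra_simps)
  ultimately have "(2 * Suc m + 1)\<^sup>2 \<le> 2 * (2 * m + 1)\<^sup>2"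
    using step(1) by linarith
  then show ?case using step by simp
qed simp

lemma two_power_gt_linear: "m \<ge> 4 \<Longrightarrow> 2 * m + 2 < 2 ^ m" for m :: nat
  by (induction m rule: dec_induct) auto

lemma not_residue_primroot_7_2: "\<not> residue_primroot 7 2"
proof
  assume *: "residue_primroot 7 2"
  have "prime (7::nat)" by simp
  then have "totient 7 = (6::nat)" by (simp add: totient_prime)
  with * have "ord 7 (2::nat) = 6" by (simp add: residue_primroot_def)
  moreover have "[2 ^ 3 = 1] (mod (7::nat))" by (simp add: cong_def)
  then have "ord 7 (2::nat) dvd 3" using ord_divides by blast
  ultimately show False by simp
qed

lemma prime_power_eqD:
  fixes p l :: nat
  assumes "prime p" "l \<ge> 1"
  shows "p ^ l = 2 \<Longrightarrow> p = 2 \<and> l = 1" "p ^ l = 3 \<Longrightarrow> p = 3 \<and> l = 1"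
    "p ^ l = 4 \<Longrightarrow> p = 2 \<and> l = 2" "p ^ l = 5 \<Longrightarrow> p = 5 \<and> l = 1"
proof -
  have "p = r \<and> l = n" if "p ^ l = r ^ n" "prime r" "n \<ge> 1" for r n
    using prime_power_inj'[of p r l n] that assms by simp
  from this[of 2 1] this[of 3 1] this[of 2 2] this[of 5 1]
  show "p ^ l = 2 \<Longrightarrow> p = 2 \<and> l = 1" "p ^ l = 3 \<Longrightarrow> p = 3 \<and> l = 1"
    "p ^ l = 4 \<Longrightarrow> p = 2 \<and> l = 2" "p ^ l = 5 \<Longrightarrow> p = 5 \<and> l = 1"
    by simp_all
qed

text \<open>With e = 2m + 1 and x = p ^ l, the power x ^ m is 2m + 2 or 2m, which is impossible for
  m \<ge> 4.\<close>

lemma small_parameters_of_unit_period: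
  fixes p l m :: nat and \<eta> :: int
  assumes p: "prime p" and l: "l \<ge> 1" and m: "m \<ge> 1"
    and primroot: "residue_primroot (2 * m + 1) p"
    and eta: "\<bar>(2 * int m + 1) * \<eta> + 1\<bar> = (int p ^ l) ^ m" "\<bar>\<eta>\<bar> = 1"
  shows "(p, 2 * m + 1, l) \<in> small_vLS_parameters"
proof -
  define x where "x = p ^ l"
  have x: "x \<ge> 2" using prime_ge_2_nat[OF p] l self_le_power[of p l] by (simp add: x_def)
  have pl: "x = 2 \<Longrightarrow> p = 2 \<and> l = 1" "x = 3 \<Longrightarrow> p = 3 \<and> l = 1"
    "x = 4 \<Longrightarrow> p = 2 \<and> l = 2" "x = 5 \<Longrightarrow> p = 5 \<and> l = 1"
    unfolding x_def by (rule prime_power_eqD[OF p l], assumption)+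
  have xm: "x ^ m = 2 * m + 2 \<or> x ^ m = 2 * m"
  proof -
    have "int (x ^ m) = \<bar>(2 * int m + 1) * \<eta> + 1\<bar>" using eta by (simp add: x_def)
    also have "\<dots> = int (2 * m + 2) \<or> \<dots> = int (2 * m)"
      using eta(2) by (cases "\<eta> = 1") (auto simp: abs_if split: if_splits)
    finally show ?thesis by (simp only: of_nat_eq_iff)
  qed
  have "2 ^ m \<le> x ^ m" using x by (intro power_mono) auto
  then have "m < 4" using xm two_power_gt_linear[of m] by linarith
  then consider "m = 1" | "m = 2" | "m = 3" using m by linarith
  then show ?thesis
  proof cases
    case 1
    then have "x = 4 \<or> x = 2" using xm by simp
    then show ?thesis
      using pl 1 by (auto simp: small_vLS_parameters_def)
  next
    case 2
    have "x = 2"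
    proof (rule ccontr)
      assume "x \<noteq> 2"
      then have "3 ^ 2 \<le> x ^ 2" using x by (intro power_mono) auto
      then show False using xm 2 by simp
    qed
    then show ?thesis
      using pl 2 by (auto simp: small_vLS_parameters_def)
  next
    case 3
    have "x = 2"
    proof (rule ccontr)
      assume "x \<noteq> 2"
      then have "3 ^ 3 \<le> x ^ 3" using x by (intro power_mono) auto
      then show False using xm 3 by simp
    qed
    \<comment> \<open>Since 2 ^ 3 = 2 * 3 + 2, the equation itself has a solution here; it is
      excluded because 2 is no primitive root modulo 7.\<close>
    then have "p = 2" using pl by simp
    then show ?thesis using 3 primroot not_residue_primroot_7_2 by simp
  qed
qed

text \<open>Let n = 2m = e - 1. Modulo X = n * \<eta> + 1 one has n * \<eta> = -1, so n ^ 3 times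
  the cubic in \<eta> is congruent to - (2n - 1)(n - 1). Thus |X| is bounded by a quadratic in n,
  while |(n + 1) * \<eta> + 1| is at least 2 ^ m.\<close>

lemma small_parameters_of_dvd:
  fixes p l m :: nat and \<eta> :: int
  assumes p: "prime p" and l: "l \<ge> 1" and m: "m \<ge> 1"
    and e: "prime (2 * m + 1)" and primroot: "residue_primroot (2 * m + 1) p"
    and eta: "\<bar>(2 * int m + 1) * \<eta> + 1\<bar> = (int p ^ l) ^ m"
    and dvd: "2 * int m * \<eta> + 1 dvd (\<eta>\<^sup>2 - (2 * int m - 2) * \<eta> - 1) * (\<eta> + 1)"
  shows "(p, 2 * m + 1, l) \<in> small_vLS_parameters"
proof -
  define x where "x = p ^ l"
  have x: "x \<ge> 2" using prime_ge_2_nat[OF p] l self_le_power[of p l] by (simp add: x_def)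
  have pl: "x = 2 \<Longrightarrow> p = 2 \<and> l = 1" "x = 3 \<Longrightarrow> p = 3 \<and> l = 1"
    "x = 4 \<Longrightarrow> p = 2 \<and> l = 2" "x = 5 \<Longrightarrow> p = 5 \<and> l = 1"
    unfolding x_def by (rule prime_power_eqD[OF p l], assumption)+
  have xm: "\<bar>(2 * int m + 1) * \<eta> + 1\<bar> = int x ^ m" using eta by (simp add: x_def)
  define n where "n = 2 * int m"
  define X where "X = n * \<eta> + 1"
  have n: "n \<ge> 2" using m by (simp add: n_def)
  have "X dvd n ^ 3 * ((\<eta>\<^sup>2 - (n - 2) * \<eta> - 1) * (\<eta> + 1))"
    using dvd by (simp add: X_def n_def)
  moreover have "n ^ 3 * ((\<eta>\<^sup>2 - (n - 2) * \<eta> - 1) * (\<eta> + 1)) + (2 * n - 1) * (n - 1) =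
      X * ((n * \<eta>) ^ 2 - n * \<eta> + 1 + (n - (n - 2) * n) * (n * \<eta> - 1) - n\<^sup>2 - (n - 2) * n\<^sup>2)"
    by (simp add: X_def algebra_simps power2_eq_square power3_eq_cube)
  ultimately have Xdvd: "X dvd (2 * n - 1) * (n - 1)"
    by (metis dvd_add_right_iff dvd_triv_left)
  then have X: "\<bar>X\<bar> \<le> (2 * n - 1) * (n - 1)"
    using n by (intro zdvd_imp_le) auto
  have "n * int x ^ m = \<bar>(n + 1) * X - 1\<bar>"
  proof -
    have "n * int x ^ m = \<bar>n * ((n + 1) * \<eta> + 1)\<bar>"
      using n xm by (simp add: abs_mult n_def)
    then show ?thesis by (simp add: X_def algebra_simps)
  qed
  also have "\<dots> \<le> (n + 1) * \<bar>X\<bar> + 1" 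
  proof -
    have "\<bar>(n + 1) * X - 1\<bar> \<le> \<bar>(n + 1) * X\<bar> + \<bar>1\<bar>" by (rule abs_triangle_ineq4)
    then show ?thesis using n by (simp add: abs_mult)
  qed
  also have "\<dots> \<le> (n + 1) * ((2 * n - 1) * (n - 1)) + 1"
    using X n by simp
  also have "\<dots> < n * (2 * (n + 1)\<^sup>2)"

  proof -
    have "n * (2 * (n + 1)\<^sup>2) - ((n + 1) * ((2 * n - 1) * (n - 1)) + 1) = 5 * n\<^sup>2 + 4 * n - 2"
      by (simp add: power2_eq_square algebra_simps)
    then show ?thesis using n by (smt (verit) zero_le_power2)
  qed
  finally have "int x ^ m < 2 * (n + 1)\<^sup>2" using n by simp
  then have "int (x ^ m) < int (2 * (2 * m + 1)\<^sup>2)" by (simp add: n_def add.commute)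
  then have bound: "x ^ m < 2 * (2 * m + 1)\<^sup>2" by (simp only: of_nat_less_iff)
  have pow: "a ^ m \<le> x ^ m" if "a \<le> x" for a using that by (intro power_mono) auto
  have "m < 10" using pow[OF x] bound two_power_gt_square[of m] by linarith
  \<comment> \<open>Here e would be 9 or 15.\<close>
  moreover have "m \<noteq> 4" "m \<noteq> 7" using e by auto
  ultimately consider "m = 1" | "m = 2" | "m = 3" | "m = 5" | "m = 6" | "m = 8" | "m = 9"
    using m by linarith
  then show ?thesis
  proof cases
    case 1
    then have "2 * \<eta> + 1 dvd 3" using Xdvd by (simp add: X_def n_def)
    then have "\<bar>2 * \<eta> + 1\<bar> \<le> 3" by (intro zdvd_imp_le) auto
    then have "\<eta> \<in> {-2, -1, 0, 1}" by auto
    then have "x \<in> {2, 4, 5}" using xm x 1 by auto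
    then show ?thesis
      using pl 1 by (auto simp: small_vLS_parameters_def)
  next
    case 2
    have "x < 8" using pow[of 8] bound 2 by (cases "x < 8") auto
    then have "x \<in> {2, 3, 4, 5, 6, 7}" using x by auto
    \<comment> \<open>For x = 4, 6, 7 the period is 3, 7, -10, and 13, 29, 39 do not divide 21. For
      x = 5 no integer \<eta> fits.\<close>
    then have "x = 2 \<or> x = 3 \<or> \<eta> = 3 \<or> \<eta> = 7 \<or> \<eta> = -10" using xm 2 by auto presburger+
    moreover have "4 * \<eta> + 1 dvd 21" using Xdvd 2 by (simp add: X_def n_def)
    ultimately have "x = 2 \<or> x = 3" by auto
    then show ?thesis
      using pl 2 by (auto simp: small_vLS_parameters_def)
  next
    case 3
    have "x < 5" using pow[of 5] bound 3 by (cases "x < 5") auto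
    then have "x \<in> {2, 3, 4}" using x by auto
    \<comment> \<open>For x = 2, 3 the period is 1, -4, and 7, 23 do not divide 55. For x = 4 it is
      9, and 6 * 9 + 1 = 55 passes the test, so the primitive root condition has to decide.\<close>
    then have "x = 4 \<or> \<eta> = 1 \<or> \<eta> = -4" using xm 3 by auto presburger+
    moreover have "6 * \<eta> + 1 dvd 55" using Xdvd 3 by (simp add: X_def n_def)
    ultimately have "x = 4" by auto
    then have "p = 2" using pl by simp
    then show ?thesis using 3 primroot not_residue_primroot_7_2 by simp
  next
    case 4
    have "x < 3" using pow[of 3] bound 4 by (cases "x < 3") auto
    then have "x = 2" using x by auto
    then have "\<eta> = -3" using xm 4 by simp presburger
    then show ?thesis using Xdvd 4 by (simp add: X_def n_def)
  next
    case 5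
    have "x < 3" using pow[of 3] bound 5 by (cases "x < 3") auto
    then have "x = 2" using x by auto
    then have "\<eta> = -5" using xm 5 by simp presburger
    then show ?thesis using Xdvd 5 by (simp add: X_def n_def)
  next
    case 6
    have "x < 3" using pow[of 3] bound 6 by (cases "x < 3") auto
    then have "x = 2" using x by auto
    then have "\<eta> = 15" using xm 6 by simp presburger
    then show ?thesis using Xdvd 6 by (simp add: X_def n_def)
  next
    case 7
    have "x < 3" using pow[of 3] bound 7 by (cases "x < 3") auto
    then have "x = 2" using x by auto
    then have "\<eta> = -27" using xm 7 by simp presburger
    then show ?thesis using Xdvd 7 by (simp add: X_def n_def)
  qed
qed

text \<open>If \<eta> is not -1, then k - d exceeds k / 2. As a divisor of k it equals k, so d = 0,
  and the formula for d makes \<eta> a divisor of 1.\<close>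

lemma unit_period_of_dvd:
  fixes \<eta> n k d :: int
  assumes n: "n \<ge> 2" and k: "k = \<eta> * ((n + 1) * \<eta> + 2)" "k > 0"
    and d: "d = \<eta>\<^sup>2 - (n - 2) * \<eta> - 1" "d \<ge> 0" and dvd: "k - d dvd k"
  shows "\<bar>\<eta>\<bar> = 1"
proof (rule ccontr)
  assume not1: "\<bar>\<eta>\<bar> \<noteq> 1"
  moreover have "\<eta> \<noteq> 0" using k by auto
  ultimately have "\<eta> * (\<eta> + 2) \<ge> 0" by (cases "\<eta> > 0") (auto intro: mult_nonpos_nonpos)
  then have "(n - 1) * (\<eta> * (\<eta> + 2)) \<ge> 0" using n by simp
  moreover have "2 * (k - d) - k = (n - 1) * (\<eta> * (\<eta> + 2)) + 2"
    unfolding k(1) d(1) by (simp add: algebra_simps power2_eq_square)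
  ultimately have lt: "k < 2 * (k - d)" by linarith
  obtain c where c: "k = (k - d) * c" using dvd by blast
  have pos: "k - d > 0" using lt k(2) by (smt (verit))
  have "c > 0" using c k(2) pos by (metis zero_less_mult_pos)
  moreover have "c < 2"
  proof (rule ccontr)
    assume "\<not> c < 2"
    then have "(k - d) * 2 \<le> (k - d) * c" using pos by (intro mult_left_mono) auto
    then show False using c lt by linarith
  qed
  ultimately have "c = 1" by linarith
  then have "d = 0" using c by simp
  then have "\<eta> * (\<eta> - (n - 2)) = 1" using d(1) by (simp add: algebra_simps power2_eq_square)
  then show False using not1 by (auto simp: zmult_eq_1_iff)
qed

text \<open>One of the two factors is a unit. If it is the second, then (n + 1) * \<eta> is -1 or
  -3, while n + 1 is at least 3.\<close>

lemma unit_period_of_prime: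
  fixes \<eta> n :: int
  assumes n: "n \<ge> 2" and prime: "prime (\<eta> * ((n + 1) * \<eta> + 2))"
  shows "\<bar>\<eta>\<bar> = 1"
proof -
  have "irreducible (\<eta> * ((n + 1) * \<eta> + 2))" 
    by (rule prime_elem_imp_irreducible[OF prime_imp_prime_elem[OF prime]])
  then have "is_unit \<eta> \<or> is_unit ((n + 1) * \<eta> + 2)" by (auto dest: irreducibleD)
  then show ?thesis
  proof
    assume "is_unit ((n + 1) * \<eta> + 2)"
    then have "\<bar>(n + 1) * \<eta> + 2\<bar> = 1" by simp
    then have "(n + 1) * \<eta> = -1 \<or> (n + 1) * \<eta> = -3" by linarith
    then have "\<bar>n + 1\<bar> * \<bar>\<eta>\<bar> \<le> 3" "\<eta> \<noteq> 0" by (auto simp: abs_mult[symmetric])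
    moreover have "3 * \<bar>\<eta>\<bar> \<le> \<bar>n + 1\<bar> * \<bar>\<eta>\<bar>" using n by (intro mult_right_mono) auto
    ultimately show ?thesis by linarith
  qed simp
qed

section \<open>Triple regularity of the van Lint--Schrijver graphs\<close>

lemma card_mult_subgroup_dvd:
  assumes K: "mult_subgroup K" "finite K" and H: "mult_subgroup H" "H \<subseteq> K"
  shows "card H dvd card K"
proof -
  note K' = mult_subgroupD[OF K(1)] and H' = mult_subgroupD[OF H(1)]
  let ?C = "(\<lambda>g. (*) g ` H) ` K"
  have union: "\<Union>?C = K"
  proof
    show "\<Union>?C \<subseteq> K" using K'(5) H(2) by auto
    show "K \<subseteq> \<Union>?C" using H'(2) by (auto intro!: bexI image_eqI[of _ _ 1])
  qed
  have coset_eq: "(*) g ` H = (*) g' ` H" if x: "g \<in> K" "g' \<in> K" "x \<in> (*) g ` H" "x \<in> (*) g' ` H" for g g' x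
  proof -
    obtain h h' where h: "h \<in> H" "h' \<in> H" "g * h = g' * h'" using x by auto
    have "h' \<noteq> 0" "h \<noteq> 0" using h H'(1) by auto
    then have g': "g' = g * (h / h')" using h(3) by (simp add: field_simps)
    have "(*) g' ` H = (*) g ` ((*) (h / h') ` H)" unfolding g' by (simp add: image_image mult.assoc)
    then show ?thesis unfolding mult_subgroup_coset[OF H(1) H'(3)[OF h(1,2)]] by simp
  qed
  have "card H * card ?C = card (\<Union>?C)"
  proof (rule card_partition)
    show "finite ?C" "finite (\<Union>?C)" using K(2) union by simp_all
    show "card c = card H" if "c \<in> ?C" for c
      using that K'(1) by (auto intro!: card_times_image)
    show "c1 \<inter> c2 = {}" if "c1 \<in> ?C" "c2 \<in> ?C" "c1 \<noteq> c2" for c1 c2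
      using that coset_eq by blast
  qed
  then show ?thesis unfolding union by (metis dvd_triv_left)
qed

text \<open>When K = -K, this counts the common neighbours of the three vertices 0, u and v in the
  Cayley graph; by translation, one vertex may be taken to be 0.\<close>

definition triangles_on :: "'a::field set \<Rightarrow> 'a \<Rightarrow> 'a \<Rightarrow> nat" where
  "triangles_on K u v = card {w \<in> K. w - u \<in> K \<and> w - v \<in> K}"

definition triply_regular :: "'a::field set \<Rightarrow> bool" where
  "triply_regular K \<longleftrightarrow> (\<forall>u v u' v'.
     (u = 0 \<longleftrightarrow> u' = 0) \<longrightarrow> (v = 0 \<longleftrightarrow> v' = 0) \<longrightarrow> (u = v \<longleftrightarrow> u' = v') \<longrightarrow>
     (u \<in> K \<longleftrightarrow> u' \<in> K) \<longrightarrow> (v \<in> K \<longleftrightarrow> v' \<in> K) \<longrightarrow> (u - v \<in> K \<longleftrightarrow> u' - v' \<in> K) \<longrightarrow>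
     triangles_on K u v = triangles_on K u' v')"

lemma triply_regularD:
  assumes "triply_regular K" "u = 0 \<longleftrightarrow> u' = 0" "v = 0 \<longleftrightarrow> v' = 0" "u = v \<longleftrightarrow> u' = v'"
    "u \<in> K \<longleftrightarrow> u' \<in> K" "v \<in> K \<longleftrightarrow> v' \<in> K" "u - v \<in> K \<longleftrightarrow> u' - v' \<in> K"
  shows "triangles_on K u v = triangles_on K u' v'"
  using assms unfolding triply_regular_def by blast

text \<open>Translation by \<omega> carries the common neighbours of 0, u, v to those of \<omega>,
  \<omega> + u, \<omega> + v.\<close>

lemma triply_regular_of_triply_transitive:
  assumes "triply_transitive (vLS_adj e :: 'a::{field,finite} \<Rightarrow> 'a \<Rightarrow> bool)" "odd e"
  shows "triply_regular (nonzero_powers e :: 'a set)"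
  unfolding triply_regular_def
proof (intro allI impI)
  let ?K = "nonzero_powers e :: 'a set" and ?E = "vLS_adj e :: 'a \<Rightarrow> 'a \<Rightarrow> bool"
  obtain \<omega> where span: "terwilliger_span ?E \<omega> = terwilliger_algebra ?E \<omega>"
    using assms(1) unfolding triply_transitive_def by blast
  have E: "?E x y \<longleftrightarrow> x - y \<in> ?K" for x y by (simp add: vLS_adj_def nonzero_powers_def)
  have sym: "x - y \<in> ?K \<longleftrightarrow> y - x \<in> ?K" for x y :: 'a
    using uminus_mem_nonzero_powers_iff[OF assms(2), of "x - y"] by simp
  have tri: "triangles_on ?K u v = card {z. ?E \<omega> z \<and> ?E (\<omega> + u) z \<and> ?E z (\<omega> + v)}" for u v
  proof -
    have "bij_betw (\<lambda>w. \<omega> + w) {w \<in> ?K. w - u \<in> ?K \<and> w - v \<in> ?K}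
        {z. ?E \<omega> z \<and> ?E (\<omega> + u) z \<and> ?E z (\<omega> + v)}"
    proof (rule bij_betwI[where g = "\<lambda>z. z - \<omega>"])
      have "?E \<omega> (\<omega> + w) \<longleftrightarrow> w \<in> ?K" "?E (\<omega> + u) (\<omega> + w) \<longleftrightarrow> w - u \<in> ?K"
        "?E (\<omega> + w) (\<omega> + v) \<longleftrightarrow> w - v \<in> ?K" for w
        unfolding E using sym[of w u] uminus_mem_nonzero_powers_iff[OF assms(2), of w] by simp_all
      note * = this this[of "_ - \<omega>"]
      show "(\<lambda>w. \<omega> + w) \<in> {w \<in> ?K. w - u \<in> ?K \<and> w - v \<in> ?K} \<rightarrow> {z. ?E \<omega> z \<and> ?E (\<omega> + u) z \<and> ?E z (\<omega> + v)}"
        using * by auto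
      show "(\<lambda>z. z - \<omega>) \<in> {z. ?E \<omega> z \<and> ?E (\<omega> + u) z \<and> ?E z (\<omega> + v)} \<rightarrow> {w \<in> ?K. w - u \<in> ?K \<and> w - v \<in> ?K}"
        using * by auto
    qed auto
    then show ?thesis unfolding triangles_on_def by (rule bij_betw_same_card)
  qed
  fix u v u' v' :: 'a
  assume "u = 0 \<longleftrightarrow> u' = 0" "v = 0 \<longleftrightarrow> v' = 0" "u = v \<longleftrightarrow> u' = v'"
    "u \<in> ?K \<longleftrightarrow> u' \<in> ?K" "v \<in> ?K \<longleftrightarrow> v' \<in> ?K" "u - v \<in> ?K \<longleftrightarrow> u' - v' \<in> ?K"
  then show "triangles_on ?K u v = triangles_on ?K u' v'"
    unfolding tri
    by (intro card_common_neighbours[OF span])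
      (auto simp: same_relation_def E uminus_mem_nonzero_powers_iff[OF assms(2)])
qed

text \<open>Multiplication by g in K preserves adjacency, so gD consists of the common neighbours of
  0 and g, and D \<inter> gD of those of 0, 1 and g.\<close>

lemma triply_regular_pds:
  assumes K: "mult_subgroup K" and minus: "\<And>x. x \<in> K \<Longrightarrow> - x \<in> K" and reg: "triply_regular K"
  shows "partial_difference_set K {x \<in> K. x - 1 \<in> K}"
proof -
  note K' = mult_subgroupD[OF K]
  let ?D = "{x \<in> K. x - 1 \<in> K}"
  have sym: "1 - x \<in> K \<longleftrightarrow> x - 1 \<in> K" for x using minus[of "1 - x"] minus[of "x - 1"] by auto
  have tri: "card (?D \<inter> (*) g ` ?D) = triangles_on K 1 g" if g: "g \<in> K" for g
  proof -
    have g0: "g \<noteq> 0" using g K'(1) by auto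
    have "w / g \<in> ?D \<longleftrightarrow> w - g \<in> K" if "w \<in> K" for w
    proof -
      have "w / g - 1 = (w - g) / g" using g0 by (simp add: field_simps)
      then have "w / g - 1 \<in> K \<longleftrightarrow> w - g \<in> K"
        using K'(3)[OF _ g, of "w - g"] K'(5)[OF _ g, of "(w - g) / g"] g0 by auto
      then show ?thesis using K'(3)[OF that g] by simp
    qed
    then have "?D \<inter> (*) g ` ?D = {w \<in> K. w - 1 \<in> K \<and> w - g \<in> K}"
      using mem_times_image_iff[OF g0] by blast
    then show ?thesis by (simp add: triangles_on_def)
  qed
  have const: "card (?D \<inter> (*) g ` ?D) = card (?D \<inter> (*) g' ` ?D)"
    if "g \<in> K" "g' \<in> K" "g \<noteq> 1" "g' \<noteq> 1" "g - 1 \<in> K \<longleftrightarrow> g' - 1 \<in> K" for g g'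
    unfolding tri[OF that(1)] tri[OF that(2)]
    by (rule triply_regularD[OF reg]) (use that K'(1,2) sym in auto)
  have D1: "1 \<notin> ?D" using K'(1) by simp
  have inv: "inverse x \<in> ?D" if "x \<in> ?D" for x
  proof -
    have "x \<noteq> 0" "x \<in> K" "x - 1 \<in> K" using that K'(1) by auto
    moreover have "inverse x - 1 = - (x - 1) / x" using \<open>x \<noteq> 0\<close> by (simp add: field_simps)
    ultimately show ?thesis using K'(3)[OF minus, of "x - 1" x] K'(4) by simp
  qed
  have ex: "\<exists>a. \<forall>g\<in>A. card (?D \<inter> (*) g ` ?D) = a"
    if eq: "\<And>g g'. g \<in> A \<Longrightarrow> g' \<in> A \<Longrightarrow> g \<in> K \<and> g' \<in> K \<and> g \<noteq> 1 \<and> g' \<noteq> 1 \<and> (g - 1 \<in> K \<longleftrightarrow> g' - 1 \<in> K)"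
    for A
  proof (cases "A = {}")
    case False
    then obtain g0 where g0: "g0 \<in> A" by blast
    have "card (?D \<inter> (*) g ` ?D) = card (?D \<inter> (*) g0 ` ?D)" if g: "g \<in> A" for g
      by (rule const) (use eq[OF g g0] in simp_all)
    then show ?thesis by blast
  qed simp
  have "\<exists>a. \<forall>g\<in>?D. card (?D \<inter> (*) g ` ?D) = a"
    by (rule ex) (use D1 in auto)
  moreover have "\<exists>b. \<forall>g\<in>K - ?D - {1}. card (?D \<inter> (*) g ` ?D) = b"
    by (rule ex) auto
  moreover have "?D \<subseteq> K - {1}" using D1 by blast
  ultimately show ?thesis
    unfolding partial_difference_set_def using inv by blast
qed

text \<open>If the local graph at 0 is a disjoint union of cliques, count the pairs \<open>(y, z)\<close> with \<open>z\<close>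
  a common neighbour of 0, 1 and \<open>y\<close>, where \<open>y\<close> is adjacent to neither 0 nor 1.\<close>

lemma triply_regular_clique_dvd:
  fixes K :: "'a::{field,finite} set"
  assumes K: "mult_subgroup K" and minus: "\<And>x. x \<in> K \<Longrightarrow> - x \<in> K" and reg: "triply_regular K"
  defines "D \<equiv> {x \<in> K. x - 1 \<in> K}"
  assumes H: "mult_subgroup (insert 1 D)"
  shows "int CARD('a) - 2 * int (card K) + int (card D) dvd int (card D) * (int (card K) - int (card D) - 1)"
proof -
  note K' = mult_subgroupD[OF K]
  let ?T = "\<lambda>c. {y. y - c \<in> K}"
  \<comment> \<open>The vertices 0 and 1 are adjacent to each other, so they are removed as
    well.\<close>
  define Y where "Y = UNIV - (K \<union> ?T 1)"
  have sym: "x - y \<in> K \<longleftrightarrow> y - x \<in> K" for x y using minus[of "x - y"] minus[of "y - x"] by auto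
  have D0: "0 \<notin> D" "1 \<notin> D" using K'(1) by (auto simp: D_def)
  have cardT: "card (?T c) = card K" for c
    by (rule bij_betw_same_card[of "\<lambda>y. y - c"], rule bij_betwI[where g = "\<lambda>y. y + c"]) auto
  have scaleD: "{y \<in> K. y - c \<in> K} = (*) c ` D" if c: "c \<in> K" for c
  proof -
    have c0: "c \<noteq> 0" using c K'(1) by auto
    have "y / c \<in> D \<longleftrightarrow> y \<in> K \<and> y - c \<in> K" for y
    proof -
      have "y / c - 1 = (y - c) / c" using c0 by (simp add: field_simps)
      moreover have "x / c \<in> K \<longleftrightarrow> x \<in> K" for x
        using K'(3)[OF _ c, of x] K'(5)[OF _ c, of "x / c"] c0 by auto
      ultimately show ?thesis by (simp add: D_def)
    qed
    then show ?thesis using mem_times_image_iff[OF c0] by blast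
  qed
  have "K \<inter> ?T 1 = D" by (auto simp: D_def)
  then have unionT: "card (K \<union> ?T 1) + card D = 2 * card K"
    using card_Un_Int[of K "?T 1"] cardT[of 1] by simp
  have cardY: "int (card Y) = int CARD('a) - 2 * int (card K) + int (card D)"
  proof -
    have "card Y + card (K \<union> ?T 1) = CARD('a)"
      unfolding Y_def by (subst card_Diff_subset) (simp_all add: card_mono)
    then show ?thesis using unionT by linarith
  qed
  \<comment> \<open>Of the |K| neighbours of z, those outside Y are adjacent to 0 or to 1. There are
    |D| of each kind and |D| - 1 of both kinds.\<close>
  have zY: "int (card {y \<in> Y. y - z \<in> K}) = int (card K) - int (card D) - 1" if z: "z \<in> D" for z
  proof -
    have zK: "z \<in> K" "z - 1 \<in> K" using z by (auto simp: D_def)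
    then have z0: "z \<noteq> 0" "z - 1 \<noteq> 0" using K'(1) by auto
    let ?A = "{y \<in> K. y - z \<in> K}" and ?B = "{y \<in> ?T 1. y - z \<in> K}"
    \<comment> \<open>Let H be the subgroup \<open>insert 1 D\<close>. Since z is in H, zD = zH -
      {z} = H - {z}.\<close>
    have A: "?A = insert 1 D - {z}"
    proof -
      have "?A = (*) z ` (insert 1 D - {1})" using scaleD[OF zK(1)] D0 by simp
      also have "\<dots> = (*) z ` insert 1 D - {z}"
        using z0 by (subst image_set_diff) (auto simp: inj_on_def)
      finally show ?thesis using mult_subgroup_coset[OF H, of z] z by (simp only: insertI2)
    qed
    have cardA: "card ?A = card D" using scaleD[OF zK(1)] card_times_image[OF z0(1)] by simp
    have cardB: "card ?B = card D"
    proof -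
      have "bij_betw (\<lambda>y. y - 1) ?B {y \<in> K. y - (z - 1) \<in> K}"
        by (rule bij_betwI[where g = "\<lambda>y. y + 1"]) (auto simp: algebra_simps)
      then have "card ?B = card {y \<in> K. y - (z - 1) \<in> K}" by (rule bij_betw_same_card)
      then show ?thesis using scaleD[OF zK(2)] card_times_image[OF z0(2)] by simp
    qed
    have "?A \<inter> ?B = ?A \<inter> D" by (auto simp: D_def)
    also have "\<dots> = D - {z}" unfolding A using D0 by auto
    finally have cardAB: "card (?A \<inter> ?B) = card D - 1" using z by simp
    have "card D > 0" using z by (auto simp: card_gt_0_iff)
    then have un: "card (?A \<union> ?B) = card D + 1"
      using card_Un_Int[of ?A ?B] cardA cardB cardAB by simp
    have "{y \<in> Y. y - z \<in> K} = ?T z - (?A \<union> ?B)" by (auto simp: Y_def)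
    moreover have "card (?T z - (?A \<union> ?B)) + card (?A \<union> ?B) = card (?T z)"
      by (subst card_Un_disjoint[symmetric]) (auto intro!: arg_cong[where f = card])
    ultimately have "card {y \<in> Y. y - z \<in> K} + card (?A \<union> ?B) = card K"
      using cardT[of z] by simp
    then show ?thesis using un by linarith
  qed
  obtain c where c: "\<And>y. y \<in> Y \<Longrightarrow> triangles_on K 1 y = c"
  proof (cases "Y = {}")
    case False
    then obtain y0 where y0: "y0 \<in> Y" by blast
    have "y \<noteq> 0" "y \<noteq> 1" "y \<notin> K" "1 - y \<notin> K" if "y \<in> Y" for y
      using that K'(2) minus[OF K'(2)] sym[of 1 y] by (auto simp: Y_def)
    then have "triangles_on K 1 y = triangles_on K 1 y0" if "y \<in> Y" for y
      using that y0 by (intro triply_regularD[OF reg]) auto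
    then show ?thesis using that by blast
  qed (use that in blast)
  have "int (card Y) * int c = (\<Sum>y\<in>Y. int (triangles_on K 1 y))" using c by simp
  also have "\<dots> = (\<Sum>y\<in>Y. \<Sum>z\<in>D. of_bool (y - z \<in> K))"
  proof (rule sum.cong[OF refl])
    fix y
    have "{w \<in> K. w - 1 \<in> K \<and> w - y \<in> K} = D \<inter> {z. y - z \<in> K}"
      using sym[of _ y] by (auto simp: D_def)
    then show "int (triangles_on K 1 y) = (\<Sum>z\<in>D. of_bool (y - z \<in> K))"
      by (simp add: triangles_on_def of_bool_def sum.If_cases)
  qed
  also have "\<dots> = (\<Sum>z\<in>D. \<Sum>y\<in>Y. of_bool (y - z \<in> K))" by (rule sum.swap)
  also have "\<dots> = (\<Sum>z\<in>D. int (card {y \<in> Y. y - z \<in> K}))"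
    by (simp add: of_bool_def sum.If_cases Int_def)
  also have "\<dots> = int (card D) * (int (card K) - int (card D) - 1)" using zY by simp
  finally show ?thesis unfolding cardY[symmetric] by (metis dvd_triv_left)
qed

theorem theorem6p19:
  fixes p e l :: nat
  assumes "prime p"
    and "prime e" and "odd e"
    and "residue_primroot e p"
    and "l \<ge> 1"
    and "CARD('a::{field,finite}) = p ^ ((e - 1) * l)"
    and "(p, e, l) \<notin> small_vLS_parameters"
  shows "\<not> triply_transitive (vLS_adj e :: 'a \<Rightarrow> 'a \<Rightarrow> bool)"
proof
  assume "triply_transitive (vLS_adj e :: 'a \<Rightarrow> 'a \<Rightarrow> bool)"
  then have reg: "triply_regular (nonzero_powers e :: 'a set)"
    using assms(3) by (rule triply_regular_of_triply_transitive)
  define K where "K = (nonzero_powers e :: 'a set)"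
  define D where "D = {x \<in> K. x - 1 \<in> K}"
  have K: "mult_subgroup K" unfolding K_def by (rule mult_subgroup_nonzero_powers)
  have minus: "- x \<in> K" if "x \<in> K" for x
    using that by (simp add: K_def uminus_mem_nonzero_powers_iff[OF assms(3)])
  have pds: "partial_difference_set K D"
    unfolding D_def using triply_regular_pds[OF K minus] reg by (simp add: K_def)
  have DK: "D \<subseteq> K - {1}" using pds by (simp add: partial_difference_set_def)
  obtain \<eta> where \<eta>: "\<bar>int e * \<eta> + 1\<bar> = int p ^ ((e - 1) div 2 * l)"
    and k: "int (card K) = \<eta> * (int e * \<eta> + 2)"
    and d: "int (card D) = \<eta>\<^sup>2 - (int e - 3) * \<eta> - 1"
    and q: "CARD('a) - 1 = e * card K" and k0: "card K > 0"
    unfolding D_def K_def by (rule uniform_cyclotomy[OF assms(1-6)])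
  define m where "m = (e - 1) div 2"
  have e: "e = 2 * m + 1" using assms(3) by (auto simp: m_def elim: oddE)
  have m: "m \<ge> 1" using assms(2) e by (cases m) auto
  define n where "n = 2 * int m"
  have n: "n \<ge> 2" "int e = n + 1" using m e by (simp_all add: n_def)
  have \<eta>_pow: "\<bar>(2 * int m + 1) * \<eta> + 1\<bar> = (int p ^ l) ^ m"
  proof -
    have "int e = 2 * int m + 1" using e by simp
    then show ?thesis using \<eta> unfolding m_def[symmetric] by (simp add: power_mult[symmetric] mult.commute)
  qed
  have k': "int (card K) = \<eta> * ((n + 1) * \<eta> + 2)" and d': "int (card D) = \<eta>\<^sup>2 - (n - 2) * \<eta> - 1"
    using k d unfolding n(2) by simp_all
  have q': "int CARD('a) = (n + 1) * int (card K) + 1"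
  proof -
    have "CARD('a) = e * card K + 1" using q zero_less_card_finite[where 'a = 'a] by linarith
    then show ?thesis by (simp only: of_nat_add of_nat_mult of_nat_1 n(2))
  qed
  have "\<eta> \<noteq> 0" using k0 k by auto
  have not_unit: "\<bar>\<eta>\<bar> \<noteq> 1"
    using small_parameters_of_unit_period[OF assms(1,5) m _ \<eta>_pow] assms(4,7) e by auto
  have not_prime: "\<not> prime (card K)"
  proof
    assume "prime (card K)"
    then have "prime (int (card K))" by simp
    then show False using unit_period_of_prime[OF n(1)] not_unit unfolding k' by blast
  qed
  have "mult_subgroup (insert 1 D) \<or> mult_subgroup (K - D)"
  proof (cases "card K = 1")
    \<comment> \<open>There is no prime r to use, but D is empty.\<close>
    case True
    then have "K = {1}" using mult_subgroupD(2)[OF K] by (auto simp: card_1_singleton_iff)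
    then show ?thesis using DK K by auto
  next
    case False
    then obtain r where r: "prime r" "r dvd card K" using prime_factor_nat by blast
    then obtain c where c: "card K = r * c" by blast
    have "card {x \<in> K. x ^ r = 1} = r"
      unfolding K_def
    proof (rule card_nonzero_powers_roots)
      show "CARD('a) - 1 = e * r * c" using q c by simp
    qed (use c k0 r(1) e prime_gt_0_nat in auto)
    \<comment> \<open>If K consisted of r-th roots of 1, then |K| = r would be prime.\<close>
    moreover from this have "{x \<in> K. x ^ r = 1} \<noteq> K" using not_prime r(1) by auto
    ultimately show ?thesis using pds_subgroup[OF K _ pds r(1)] by simp
  qed
  then show False
  proof
    assume "mult_subgroup (K - D)"
    then have "card (K - D) dvd card K" using card_mult_subgroup_dvd[OF K] by simp
    moreover have "int (card (K - D)) = int (card K) - int (card D)"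
    proof -
      have "D \<subseteq> K" using DK by blast
      then have "card (K - D) = card K - card D" "card D \<le> card K"
        by (simp_all add: card_Diff_subset card_mono)
      then show ?thesis by simp
    qed
    ultimately have "int (card K) - int (card D) dvd int (card K)" by (metis int_dvd_int_iff)
    then have "\<bar>\<eta>\<bar> = 1" using unit_period_of_dvd[OF n(1) k' _ d'] k0 by simp
    then show False using not_unit by simp
  next
    assume "mult_subgroup (insert 1 D)"
    then have "int CARD('a) - 2 * int (card K) + int (card D)
        dvd int (card D) * (int (card K) - int (card D) - 1)"
      using triply_regular_clique_dvd[OF K minus] reg unfolding D_def K_def by blast
    \<comment> \<open>Both sides of the divisibility contain the nonzero factor n * \<eta>, which
      cancels.\<close>
    moreover have "int CARD('a) - 2 * int (card K) + int (card D) = (n * \<eta>) * (n * \<eta> + 1)"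
      unfolding q' k' d' by (simp add: algebra_simps power2_eq_square)
    moreover have "int (card D) * (int (card K) - int (card D) - 1) =
        (n * \<eta>) * ((\<eta>\<^sup>2 - (n - 2) * \<eta> - 1) * (\<eta> + 1))"
      unfolding k' d' by (simp add: algebra_simps power2_eq_square)
    ultimately have "n * \<eta> + 1 dvd (\<eta>\<^sup>2 - (n - 2) * \<eta> - 1) * (\<eta> + 1)"
      using n(1) \<open>\<eta> \<noteq> 0\<close> by simp
    then have "(p, 2 * m + 1, l) \<in> small_vLS_parameters"
      using small_parameters_of_dvd[OF assms(1,5) m _ _ \<eta>_pow] assms(2,4) e by (simp add: n_def)
    then show False using assms(7) e by simp
  qed
qed

end
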